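(* Let $G$ be an abelian group, $\mathbb{F}$ a field, and let $\mathcal{U}$ be a $G$-graded $\mathbb{F}$-algebra such that the multiplication algebra $M(\mathcal{U})$ satisfies an ordinary polynomial identity. Then $\mathcal{U}$ is a graded simple algebra if and only if $M(\mathcal{U})$ is a graded simple algebra. Moreover, in this case $\mathcal{U}$ has finite dimension as a graded vector space over the graded centroid $\Gamma(\mathcal{U})$, and $M(\mathcal{U})=\mathrm{End}_{\Gamma(\mathcal{U})}\,\mathcal{U}$.
   Context: Algebras are not assumed associative or unital. A $G$-grading on an $\mathbb{F}$-algebra $\mathcal{U}$ is a decomposition $\mathcal{U}=\bigoplus_{g\in G}\mathcal{U}_g$ with $\mathcal{U}_g\mathcal{U}_h\subseteq\mathcal{U}_{gh}$. A subspace $V$ is homogeneous if $V=\bigoplus_g (V\cap\mathcal{U}_g)$. A graded algebra $\mathcal{U}$ is graded simple if $\mathcal{U}^2\ne 0$ and it has no homogeneous two-sided ideals other than $0$ and itself. A graded division algebra is a unital associative graded algebra in which every nonzero homogeneous element is invertible; a graded vector space is a graded module over a graded division algebra, and its dimension is the cardinality of a basis. The multiplication algebra $M(\mathcal{U})$ is the subalgebra of $\mathrm{End}_{\mathbb{F}}\,\mathcal{U}$ generated by all left and right multiplications by elements of $\mathcal{U}$. Let $(\mathrm{End}_{\mathbb{F}}\,\mathcal{U})^{gr}=\bigoplus_{g\in G}E_g$, where $E_g$ is the set of linear maps $\varphi$ with $\varphi(\mathcal{U}_h)\subseteq\mathcal{U}_{gh}$ for all $h\in G$. Since $G$ is abelian,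 $M(\mathcal{U})$ is a homogeneous subalgebra of $(\mathrm{End}_{\mathbb{F}}\,\mathcal{U})^{gr}$, hence $G$-graded, and $\mathcal{U}$ is a graded left $M(\mathcal{U})$-module. The graded centroid $\Gamma(\mathcal{U})=(\mathrm{End}_{M(\mathcal{U})}\,\mathcal{U})^{gr}$ is the span of the homogeneous $M(\mathcal{U})$-module endomorphisms of $\mathcal{U}$, i.e. of those $M(\mathcal{U})$-module endomorphisms $\varphi$ of $\mathcal{U}$ for which there is some $g\in G$ with $\varphi(\mathcal{U}_h)\subseteq\mathcal{U}_{gh}$ for all $h\in G$; if $\mathcal{U}$ is graded simple it is a commutative graded division algebra. An associative algebra $A$ satisfies an ordinary polynomial identity if there is a nonzero $f(x_1,\dots,x_n)$ in the free associative algebra $\mathbb{F}\langle X\rangle$ on a countable set $X$ with $f(a_1,\dots,a_n)=0$ for all $a_1,\dots,a_n\in A$.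
   Formalization: The converse is false as stated (U = Fe⊕Fn with ee = e and all other products 0: M(U) ≅ F is graded simple, U is not). It is proved with the added condition that no nonzero x in U has xU = Ux = 0; graded simplicity of U implies this condition. *)

theory Defs
  imports Complex_Main "HOL-Library.Function_Algebras" "HOL-Library.Poly_Mapping"
begin

text \<open>
  The grading group is an arbitrary type of class \<^class>\<open>ab_group_add\<close>, hence written additively.
  An algebra lives on a subset \<open>A\<close> of a type of class \<^class>\<open>ab_group_add\<close>, so that the same notions
  apply to an algebra occupying a whole type \<open>'u\<close> and to algebras of endomorphisms of it, which are
  sets of functions \<open>'u \<Rightarrow> 'u\<close> (with the pointwise additive group structure).
\<close>

section \<open>Graded algebras\<close>

definition direct_sum_decomposition ::
    "('f::field \<Rightarrow> 'a::ab_group_add \<Rightarrow> 'a) \<Rightarrow> 'a set \<Rightarrow> ('g \<Rightarrow> 'a set) \<Rightarrow> bool" where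
  "direct_sum_decomposition scale V C \<longleftrightarrow>
     (\<forall>g. module.subspace scale (C g)) \<and>
     module.span scale (\<Union>g. C g) = V \<and>
     (\<forall>S v. finite S \<longrightarrow> (\<forall>g\<in>S. v g \<in> C g) \<longrightarrow> (\<Sum>g\<in>S. v g) = 0 \<longrightarrow> (\<forall>g\<in>S. v g = 0))"

definition homogeneous_subspace ::
    "('f::field \<Rightarrow> 'a::ab_group_add \<Rightarrow> 'a) \<Rightarrow> ('g \<Rightarrow> 'a set) \<Rightarrow> 'a set \<Rightarrow> bool" where
  "homogeneous_subspace scale C V \<longleftrightarrow> direct_sum_decomposition scale V (\<lambda>g. V \<inter> C g)"

text \<open>Bilinearity is only required on the carrier: composition is not bilinear on all functions.\<close>

locale nonassoc_algebra = vector_space scale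
  for scale :: "'f::field \<Rightarrow> 'a::ab_group_add \<Rightarrow> 'a" +
  fixes A :: "'a set" and mult :: "'a \<Rightarrow> 'a \<Rightarrow> 'a"
  assumes subspace_carrier: "subspace A"
    and mult_closed: "x \<in> A \<Longrightarrow> y \<in> A \<Longrightarrow> mult x y \<in> A"
    and mult_add_left: "x \<in> A \<Longrightarrow> y \<in> A \<Longrightarrow> z \<in> A \<Longrightarrow> mult (x + y) z = mult x z + mult y z"
    and mult_add_right: "x \<in> A \<Longrightarrow> y \<in> A \<Longrightarrow> z \<in> A \<Longrightarrow> mult x (y + z) = mult x y + mult x z"
    and mult_scale_left: "x \<in> A \<Longrightarrow> y \<in> A \<Longrightarrow> mult (scale c x) y = scale c (mult x y)"
    and mult_scale_right: "x \<in> A \<Longrightarrow> y \<in> A \<Longrightarrow> mult x (scale c y) = scale c (mult x y)"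

locale graded_algebra = nonassoc_algebra scale A mult
  for scale :: "'f::field \<Rightarrow> 'a::ab_group_add \<Rightarrow> 'a" and A and mult +
  fixes C :: "'g::ab_group_add \<Rightarrow> 'a set"
  assumes grading: "direct_sum_decomposition scale A C"
    and mult_graded: "x \<in> C g \<Longrightarrow> y \<in> C h \<Longrightarrow> mult x y \<in> C (g + h)"

definition two_sided_ideal ::
    "('f::field \<Rightarrow> 'a::ab_group_add \<Rightarrow> 'a) \<Rightarrow> 'a set \<Rightarrow> ('a \<Rightarrow> 'a \<Rightarrow> 'a) \<Rightarrow> 'a set \<Rightarrow> bool" where
  "two_sided_ideal scale A mult I \<longleftrightarrow>
     I \<subseteq> A \<and> module.subspace scale I \<and> (\<forall>a\<in>A. \<forall>x\<in>I. mult a x \<in> I \<and> mult x a \<in> I)"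

locale graded_simple_algebra = graded_algebra +
  assumes square_nonzero: "span {mult x y | x y. x \<in> A \<and> y \<in> A} \<noteq> {0}"
    and no_proper_ideals:
      "two_sided_ideal scale A mult I \<Longrightarrow> homogeneous_subspace scale C I \<Longrightarrow> I = {0} \<or> I = A"

text \<open>
  Direct summands with zero multiplication are invisible to the multiplication algebra: for
  \<open>U = F \<times> N\<close> with \<open>N \<cdot> U = U \<cdot> N = 0\<close> it is \<open>F\<close> for every \<open>N\<close>. Graded simplicity of the
  multiplication algebra can therefore imply that of \<open>U\<close> only if the annihilator vanishes.
\<close>

definition annihilator :: "('a::zero \<Rightarrow> 'a \<Rightarrow> 'a) \<Rightarrow> 'a set" where
  "annihilator mult = {x. \<forall>y. mult x y = 0 \<and> mult y x = 0}"

section \<open>Endomorphisms\<close>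

definition fun_scale :: "('f \<Rightarrow> 'u \<Rightarrow> 'u) \<Rightarrow> 'f \<Rightarrow> ('u \<Rightarrow> 'u) \<Rightarrow> 'u \<Rightarrow> 'u" where
  "fun_scale scale c \<phi> = (\<lambda>x. scale c (\<phi> x))"

definition endomorphisms :: "('f::field \<Rightarrow> 'u::ab_group_add \<Rightarrow> 'u) \<Rightarrow> ('u \<Rightarrow> 'u) set" where
  "endomorphisms scale = {\<phi>. Vector_Spaces.linear scale scale \<phi>}"

definition endomorphisms_of_degree ::
    "('f::field \<Rightarrow> 'u::ab_group_add \<Rightarrow> 'u) \<Rightarrow> ('g::ab_group_add \<Rightarrow> 'u set) \<Rightarrow> 'g \<Rightarrow> ('u \<Rightarrow> 'u) set" where
  "endomorphisms_of_degree scale C g =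
     {\<phi> \<in> endomorphisms scale. \<forall>h. \<phi> ` C h \<subseteq> C (g + h)}"

text \<open>\<open>End\<^sub>X(U)\<close> for a set \<open>X\<close> of endomorphisms of the vector space \<open>U\<close>.\<close>

definition endomorphisms_over ::
    "('f::field \<Rightarrow> 'u::ab_group_add \<Rightarrow> 'u) \<Rightarrow> ('u \<Rightarrow> 'u) set \<Rightarrow> ('u \<Rightarrow> 'u) set" where
  "endomorphisms_over scale X =
     {\<phi> \<in> endomorphisms scale. \<forall>\<xi>\<in>X. \<forall>u. \<phi> (\<xi> u) = \<xi> (\<phi> u)}"

section \<open>Multiplication algebra and graded centroid\<close>

definition endomorphism_subalgebra ::
    "('f::field \<Rightarrow> 'u::ab_group_add \<Rightarrow> 'u) \<Rightarrow> ('u \<Rightarrow> 'u) set \<Rightarrow> bool" where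
  "endomorphism_subalgebra scale B \<longleftrightarrow>
     B \<subseteq> endomorphisms scale \<and> module.subspace (fun_scale scale) B \<and>
     (\<forall>\<phi>\<in>B. \<forall>\<psi>\<in>B. \<phi> \<circ> \<psi> \<in> B)"

text \<open>Subalgebras, and hence the multiplication algebra, need not contain the identity map.\<close>

definition multiplication_algebra ::
    "('f::field \<Rightarrow> 'u::ab_group_add \<Rightarrow> 'u) \<Rightarrow> ('u \<Rightarrow> 'u \<Rightarrow> 'u) \<Rightarrow> ('u \<Rightarrow> 'u) set" where
  "multiplication_algebra scale mult =
     endomorphism_subalgebra scale hull (range (\<lambda>a x. mult a x) \<union> range (\<lambda>a x. mult x a))"

definition multiplication_algebra_component ::
    "('f::field \<Rightarrow> 'u::ab_group_add \<Rightarrow> 'u) \<Rightarrow> ('u \<Rightarrow> 'u \<Rightarrow> 'u) \<Rightarrow> ('g::ab_group_add \<Rightarrow> 'u set)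
      \<Rightarrow> 'g \<Rightarrow> ('u \<Rightarrow> 'u) set" where
  "multiplication_algebra_component scale mult C g =
     multiplication_algebra scale mult \<inter> endomorphisms_of_degree scale C g"

definition graded_centroid ::
    "('f::field \<Rightarrow> 'u::ab_group_add \<Rightarrow> 'u) \<Rightarrow> ('u \<Rightarrow> 'u \<Rightarrow> 'u) \<Rightarrow> ('g::ab_group_add \<Rightarrow> 'u set)
      \<Rightarrow> ('u \<Rightarrow> 'u) set" where
  "graded_centroid scale mult C =
     module.span (fun_scale scale)
       (\<Union>g. endomorphisms_over scale (multiplication_algebra scale mult)
              \<inter> endomorphisms_of_degree scale C g)"

text \<open>
  A basis of a graded vector space over a graded division algebra \<open>\<Gamma>\<close> consists of homogeneous
  elements. Here \<open>\<Gamma>\<close> is given as a set of maps acting on the space.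
\<close>

definition graded_basis ::
    "('u::ab_group_add \<Rightarrow> 'u) set \<Rightarrow> ('g \<Rightarrow> 'u set) \<Rightarrow> 'u set \<Rightarrow> bool" where
  "graded_basis \<Gamma> C B \<longleftrightarrow>
     B \<subseteq> (\<Union>g. C g) \<and>
     (\<forall>S \<gamma>. finite S \<longrightarrow> S \<subseteq> B \<longrightarrow> (\<forall>b\<in>S. \<gamma> b \<in> \<Gamma>) \<longrightarrow> (\<Sum>b\<in>S. \<gamma> b b) = 0 \<longrightarrow> (\<forall>b\<in>S. \<gamma> b = 0)) \<and>
     (\<forall>u. \<exists>S \<gamma>. finite S \<and> S \<subseteq> B \<and> (\<forall>b\<in>S. \<gamma> b \<in> \<Gamma>) \<and> u = (\<Sum>b\<in>S. \<gamma> b b))"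

section \<open>Polynomial identities\<close>

text \<open>
  An element of the free associative algebra on \<open>x\<^sub>0, x\<^sub>1, \<dots>\<close> is a finitely supported family of
  coefficients indexed by words in \<^typ>\<open>nat\<close>. The empty word is evaluated to \<open>one\<close>, the unit of
  an associative algebra containing \<open>A\<close>. It need not lie in \<open>A\<close>: substituting \<open>0\<close> for all
  variables shows that the constant term of an identity vanishes as soon as \<open>one \<noteq> 0\<close>.
\<close>

definition nc_poly_eval ::
    "('f::field \<Rightarrow> 'a::ab_group_add \<Rightarrow> 'a) \<Rightarrow> ('a \<Rightarrow> 'a \<Rightarrow> 'a) \<Rightarrow> 'a \<Rightarrow> (nat list \<Rightarrow>\<^sub>0 'f) \<Rightarrow> (nat \<Rightarrow> 'a) \<Rightarrow> 'a"
  where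
  "nc_poly_eval scale mult one f a =
     (\<Sum>w\<in>Poly_Mapping.keys f. scale (Poly_Mapping.lookup f w) (foldr mult (map a w) one))"

definition satisfies_polynomial_identity ::
    "('f::field \<Rightarrow> 'a::ab_group_add \<Rightarrow> 'a) \<Rightarrow> 'a set \<Rightarrow> ('a \<Rightarrow> 'a \<Rightarrow> 'a) \<Rightarrow> 'a \<Rightarrow> bool" where
  "satisfies_polynomial_identity scale A mult one \<longleftrightarrow>
     (\<exists>f. f \<noteq> 0 \<and> (\<forall>a. range a \<subseteq> A \<longrightarrow> nc_poly_eval scale mult one f a = 0))"

end

theory Submission
  imports Defs "HOL-Library.Sublist"
begin

text \<open>
  Write \<open>M\<close> for the multiplication algebra of \<open>U\<close>. The two-sided ideals of \<open>U\<close> are its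
  \<open>M\<close>-submodules, so the question is about a graded algebra \<open>M\<close> of endomorphisms that satisfies a
  polynomial identity and acts on a graded irreducible module \<open>V\<close> without vectors killed by \<open>M\<close>.

  Density has an elementary form here. Call a list of homogeneous vectors of \<open>V\<close> independent if every
  entry is moved by some element of \<open>M\<close> that kills the later entries. By irreducibility the elements
  killing the later entries then carry this entry to all of \<open>V\<close>, and triangular elimination shows that
  an element of \<open>M\<close> can take arbitrary values on the list (\<open>interpolation\<close>). If a polynomial has
  a word \<open>w\<close> of maximal length \<open>d\<close> and \<open>v\<^sub>0, \<dots>, v\<^sub>d\<close> is such a list, then one can let the variables act as
  partial shifts along \<open>w\<close>, so that the polynomial sends \<open>v\<^sub>0\<close> to a vector with a nonzero coefficient
  at \<open>v\<^sub>d\<close>. An identity therefore bounds the length of independent lists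
  (\<open>independent_list_length_le\<close>). On a maximal list an element of \<open>M\<close> is determined by its values, and
  it follows that \<open>M\<close> contains an element acting as the identity on \<open>V\<close> (\<open>exists_identity\<close>).

  If \<open>U\<close> is graded simple, this applies to \<open>V = U\<close>. A homogeneous vector killed by everything
  that kills a finite set is a combination of that set with coefficients in the graded centralizer of
  \<open>M\<close>, which is the graded centroid (\<open>double_annihilator\<close>). So a maximal independent list is a graded
  basis, and interpolation on it gives both \<open>M = End\<^sub>\<Gamma>(U)\<close> and the graded simplicity of \<open>M\<close>.

  Conversely, let \<open>M\<close> be graded simple and let the annihilator of \<open>U\<close> vanish. The elements of
  \<open>M\<close> mapping \<open>U\<close> into a nonzero homogeneous ideal \<open>I\<close> form a nonzero homogeneous ideal of \<open>M\<close>, so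
  \<open>M U \<subseteq> I\<close>. Hence the span \<open>V\<close> of \<open>M U\<close> is the least nonzero homogeneous ideal of \<open>U\<close>; it is graded
  irreducible, and \<open>M\<close> acts faithfully on it because \<open>M\<close> is graded simple. The element \<open>e \<in> M\<close> that is
  the identity on \<open>V\<close> is thus a right unit of \<open>M\<close>. Since \<open>M (e x - x) = 0\<close>, every \<open>x = e x\<close> lies
  in \<open>V\<close>, and \<open>V = U\<close>. The identity is essential in this step: it is what provides \<open>e\<close>.
\<close>

section \<open>Direct sums and homogeneous subspaces\<close>

lemma sum_fun_eval: "(\<Sum>g\<in>S. \<phi> g) x = (\<Sum>g\<in>S. \<phi> g x)"
  by (induction S rule: infinite_finite_induct) auto

context vector_space
begin

lemma span_Union_obtain:
  assumes sub: "\<And>g. subspace (D g)" and x: "x \<in> span (\<Union>g. D g)"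
  obtains S v where "finite S" "\<And>g. v g \<in> D g" "x = (\<Sum>g\<in>S. v g)"
proof -
  define P where "P y \<longleftrightarrow> (\<exists>S v. finite S \<and> (\<forall>g. v g \<in> D g) \<and> (\<forall>g. g \<notin> S \<longrightarrow> v g = 0)
    \<and> y = (\<Sum>g\<in>S. v g))" for y
  have "P x"
    using x
  proof (induction rule: span_induct)
    case base
    have "P 0"
      unfolding P_def by (rule exI[of _ "{}"]) (use sub in \<open>auto intro!: exI[of _ "\<lambda>_. 0"] subspace_0\<close>)
    moreover have "P (y + z)" if y: "P y" and z: "P z" for y z
    proof -
      obtain S v where v: "finite S" "\<forall>g. v g \<in> D g" "\<forall>g. g \<notin> S \<longrightarrow> v g = 0" "y = (\<Sum>g\<in>S. v g)"
        using y unfolding P_def by blast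
      obtain T w where w: "finite T" "\<forall>g. w g \<in> D g" "\<forall>g. g \<notin> T \<longrightarrow> w g = 0" "z = (\<Sum>g\<in>T. w g)"
        using z unfolding P_def by blast
      have "y = (\<Sum>g\<in>S \<union> T. v g)" "z = (\<Sum>g\<in>S \<union> T. w g)"
        unfolding v(4) w(4) by (rule sum.mono_neutral_left; use v w in auto)+
      then have "y + z = (\<Sum>g\<in>S \<union> T. v g + w g)"
        by (simp add: sum.distrib)
      then show ?thesis
        unfolding P_def using v w sub
        by (intro exI[of _ "S \<union> T"] exI[of _ "\<lambda>g. v g + w g"]) (auto intro: subspace_add)
    qed
    moreover have "P (scale c y)" if y: "P y" for c y
    proof -
      obtain S v where v: "finite S" "\<forall>g. v g \<in> D g" "\<forall>g. g \<notin> S \<longrightarrow> v g = 0" "y = (\<Sum>g\<in>S. v g)"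
        using y unfolding P_def by blast
      then show ?thesis
        unfolding P_def using sub
        by (intro exI[of _ S] exI[of _ "\<lambda>g. scale c (v g)"])
           (auto intro: subspace_scale simp: scale_sum_right)
    qed
    ultimately show ?case
      by (simp add: subspace_def)
  next
    case (step y)
    then obtain g where g: "y \<in> D g" by blast
    show ?case
      unfolding P_def using sub g
      by (intro exI[of _ "{g}"] exI[of _ "\<lambda>h. if h = g then y else 0"]) (auto intro: subspace_0)
  qed
  then show ?thesis
    unfolding P_def using that by blast
qed

lemma homogeneous_subspaceI:
  assumes C: "direct_sum_decomposition scale V C" and W: "subspace W"
    and gen: "\<And>x. x \<in> W \<Longrightarrow> x \<in> span (\<Union>g. W \<inter> C g)"
  shows "homogeneous_subspace scale C W"
proof -
  have "span (\<Union>g. W \<inter> C g) \<subseteq> W"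
    by (rule span_minimal) (use W in auto)
  then show ?thesis
    using C W gen unfolding homogeneous_subspace_def direct_sum_decomposition_def
    by (auto intro: subspace_inter)
qed

lemma homogeneous_subspace_obtain:
  assumes "homogeneous_subspace scale C W" "x \<in> W"
  obtains S v where "finite S" "\<And>g. v g \<in> W" "\<And>g. v g \<in> C g" "x = (\<Sum>g\<in>S. v g)"
proof -
  have "\<And>g. subspace (W \<inter> C g)" "x \<in> span (\<Union>g. W \<inter> C g)"
    using assms by (simp_all add: homogeneous_subspace_def direct_sum_decomposition_def)
  then show ?thesis
    by (rule span_Union_obtain) (use that in blast)
qed

lemma homogeneous_subspace_subspace:
  assumes "homogeneous_subspace scale C W"
  shows "subspace W"
  using assms by (metis homogeneous_subspace_def direct_sum_decomposition_def subspace_span)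

text \<open>
  The summands are indexed through an injection because the components of \<open>\<phi> u\<close>, for \<open>u\<close> of degree
  \<open>h\<close>, come as \<open>\<phi>\<^sub>g u\<close> with \<open>\<phi>\<^sub>g\<close> of degree \<open>g\<close>, hence in degree \<open>g + h\<close>.
\<close>

lemma homogeneous_component:
  assumes C: "direct_sum_decomposition scale V C" and W: "homogeneous_subspace scale C W"
    and S: "finite S" "inj_on f S" and v: "\<And>g. g \<in> S \<Longrightarrow> v g \<in> C (f g)"
    and sum: "(\<Sum>g\<in>S. v g) \<in> W" and g: "g \<in> S"
  shows "v g \<in> W"
proof -
  define w where "w k = (if k \<in> f ` S then v (inv_into S f k) else 0)" for k
  have sub: "subspace (C k)" for k
    using C by (simp add: direct_sum_decomposition_def)
  have wC: "w k \<in> C k" for k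
    using v sub[of k] S by (auto simp: w_def subspace_0)
  have "(\<Sum>g\<in>S. v g) = (\<Sum>k\<in>f ` S. w k)"
    using S by (auto simp: sum.reindex w_def intro!: sum.cong)
  with sum have "(\<Sum>k\<in>f ` S. w k) \<in> W"
    by simp
  then obtain T u where T: "finite T" "\<And>k. u k \<in> W" "\<And>k. u k \<in> C k"
      "(\<Sum>k\<in>f ` S. w k) = (\<Sum>k\<in>T. u k)"
    by (rule homogeneous_subspace_obtain[OF W]) blast
  define u' where "u' k = (if k \<in> T then u k else 0)" for k
  have u': "u' k \<in> W" "u' k \<in> C k" for k
    using T homogeneous_subspace_subspace[OF W] sub by (auto simp: u'_def subspace_0)
  define R where "R = f ` S \<union> T"
  have R: "finite R"
    using S T by (simp add: R_def)
  have "(\<Sum>k\<in>R. w k) = (\<Sum>k\<in>f ` S. w k)" "(\<Sum>k\<in>R. u' k) = (\<Sum>k\<in>T. u k)"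
    by (rule sum.mono_neutral_cong_right; use S T in \<open>auto simp: R_def w_def u'_def\<close>)+
  with T(4) have "(\<Sum>k\<in>R. w k - u' k) = 0"
    by (simp add: sum_subtractf)
  moreover have "w k - u' k \<in> C k" for k
    using wC u' sub by (auto intro: subspace_diff)
  ultimately have "w k - u' k = 0" if "k \<in> R" for k
    using C R that unfolding direct_sum_decomposition_def by (metis (no_types, lifting))
  then have "w (f g) = u' (f g)"
    using g by (simp add: R_def)
  moreover have "w (f g) = v g"
    using g S by (simp add: w_def)
  ultimately show ?thesis
    using u'(1)[of "f g"] by simp
qed

lemma homogeneous_subspace_zero:
  assumes "direct_sum_decomposition scale V C"
  shows "homogeneous_subspace scale C {0}"
  by (rule homogeneous_subspaceI[OF assms]) (auto simp: subspace_0 span_zero)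

lemma direct_sum_independent:
  assumes C: "direct_sum_decomposition scale V C"
    and S: "finite S" "inj_on f S" and v: "\<And>g. g \<in> S \<Longrightarrow> v g \<in> C (f g)"
    and sum: "(\<Sum>g\<in>S. v g) = 0" and g: "g \<in> S"
  shows "v g = 0"
  using homogeneous_component[OF C homogeneous_subspace_zero[OF C] S v _ g] sum by auto

lemma endomorphisms_iff:
  "\<phi> \<in> endomorphisms scale \<longleftrightarrow>
     (\<forall>x y. \<phi> (x + y) = \<phi> x + \<phi> y) \<and> (\<forall>c x. \<phi> (scale c x) = scale c (\<phi> x))"
  using vector_space_axioms by (auto simp: endomorphisms_def Vector_Spaces.linear_iff)

end

lemma vector_space_fun_scale:
  assumes "vector_space scale"
  shows "vector_space (fun_scale scale)"
proof -
  interpret vector_space scale by fact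
  show ?thesis
    by unfold_locales (auto simp: fun_scale_def fun_eq_iff scale_right_distrib scale_left_distrib)
qed

section \<open>Graded modules over algebras of endomorphisms\<close>

locale graded_module = vector_space scale
  for scale :: "'f::field \<Rightarrow> 'u::ab_group_add \<Rightarrow> 'u" +
  fixes C :: "'g::ab_group_add \<Rightarrow> 'u set" and M :: "('u \<Rightarrow> 'u) set"
  assumes grading: "direct_sum_decomposition scale UNIV C"
    and subalgebra: "endomorphism_subalgebra scale M"
    and homogeneous_span: "M \<subseteq> module.span (fun_scale scale) (\<Union>g. M \<inter> endomorphisms_of_degree scale C g)"
begin

sublocale E: vector_space "fun_scale scale"
  by (rule vector_space_fun_scale) (rule vector_space_axioms)

lemma component_subspace: "subspace (C g)"
  using grading by (simp add: direct_sum_decomposition_def)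

lemma component_homogeneous: "homogeneous_subspace scale C (C h)"
  using component_subspace by (intro homogeneous_subspaceI[OF grading]) (auto intro: span_base)

lemma components_disjoint:
  assumes "x \<in> C g" "x \<in> C h" "g \<noteq> h"
  shows "x = 0"
proof -
  have "(if k = g then x else - x) \<in> C k" if "k \<in> {g, h}" for k
    using that assms component_subspace[of h] by (auto intro: subspace_neg)
  from direct_sum_independent[OF grading, of "{g, h}" "\<lambda>k. k", OF _ _ this, of g] show ?thesis
    using assms(3) by simp
qed

lemma M_linear:
  assumes "\<phi> \<in> M"
  shows "\<phi> (x + y) = \<phi> x + \<phi> y" "\<phi> (scale c x) = scale c (\<phi> x)" "\<phi> 0 = 0" "\<phi> (x - y) = \<phi> x - \<phi> y"
    "\<phi> (\<Sum>i\<in>I. v i) = (\<Sum>i\<in>I. \<phi> (v i))"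
proof -
  have "\<phi> \<in> endomorphisms scale"
    using assms subalgebra by (auto simp: endomorphism_subalgebra_def)
  then interpret Vector_Spaces.linear scale scale \<phi>
    by (simp add: endomorphisms_def)
  show "\<phi> (x + y) = \<phi> x + \<phi> y" "\<phi> (scale c x) = scale c (\<phi> x)" "\<phi> 0 = 0" "\<phi> (x - y) = \<phi> x - \<phi> y"
    "\<phi> (\<Sum>i\<in>I. v i) = (\<Sum>i\<in>I. \<phi> (v i))"
    by (simp_all add: add scale zero diff sum)
qed

lemma M_closed:
  shows "E.subspace M" and "\<phi> \<in> M \<Longrightarrow> \<psi> \<in> M \<Longrightarrow> \<phi> \<circ> \<psi> \<in> M"
  using subalgebra by (auto simp: endomorphism_subalgebra_def)

lemma degree_subspace: "E.subspace (endomorphisms_of_degree scale C g)"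
  unfolding E.subspace_def endomorphisms_of_degree_def
  using component_subspace
  by (auto simp: endomorphisms_iff fun_scale_def algebra_simps image_subset_iff scale_left_commute
      subspace_0 subspace_add subspace_scale)

lemma homogeneous_parts:
  assumes "\<phi> \<in> M"
  obtains S \<psi> where "finite S" "\<And>g. \<psi> g \<in> M" "\<And>g. \<psi> g \<in> endomorphisms_of_degree scale C g"
    "\<phi> = (\<Sum>g\<in>S. \<psi> g)"
proof -
  have "E.subspace (M \<inter> endomorphisms_of_degree scale C g)" for g
    using M_closed(1) degree_subspace by (rule E.subspace_inter)
  moreover have "\<phi> \<in> E.span (\<Union>g. M \<inter> endomorphisms_of_degree scale C g)"
    using assms homogeneous_span by blast
  ultimately show ?thesis
    by (rule E.span_Union_obtain) (use that in blast)
qed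

lemma degree_apply: "\<psi> \<in> endomorphisms_of_degree scale C g \<Longrightarrow> x \<in> C h \<Longrightarrow> \<psi> x \<in> C (g + h)"
  by (auto simp: endomorphisms_of_degree_def)

lemma homogeneous_parts_mem:
  assumes W: "homogeneous_subspace scale C W" and S: "finite S"
    and \<psi>: "\<And>g. \<psi> g \<in> endomorphisms_of_degree scale C g"
    and x: "x \<in> C h" and sum: "(\<Sum>g\<in>S. \<psi> g) x \<in> W" and g: "g \<in> S"
  shows "\<psi> g x \<in> W"
  by (rule homogeneous_component[OF grading W S, of "\<lambda>g. g + h" "\<lambda>g. \<psi> g x"])
     (use \<psi> x sum g in \<open>auto simp: sum_fun_eval inj_on_def intro: degree_apply\<close>)

definition killing :: "'u set \<Rightarrow> ('u \<Rightarrow> 'u) set" where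
  "killing S = {\<phi> \<in> M. \<forall>x\<in>S. \<phi> x = 0}"

lemma killing_subspace: "E.subspace (killing S)"
  unfolding killing_def using M_closed(1)
  by (auto simp: E.subspace_def) (simp_all add: fun_scale_def)

text \<open>
  Homogeneity of \<open>S\<close> is what makes the left ideal homogeneous: the components of an element killing
  \<open>x\<close> send a homogeneous \<open>x\<close> into different degrees.
\<close>

lemma killing_parts:
  assumes S: "S \<subseteq> (\<Union>g. C g)" and \<phi>: "\<phi> \<in> killing S"
  obtains T \<psi> where "finite T" "\<And>g. g \<in> T \<Longrightarrow> \<psi> g \<in> killing S"
    "\<And>g. \<psi> g \<in> endomorphisms_of_degree scale C g" "\<phi> = (\<Sum>g\<in>T. \<psi> g)"
proof -
  obtain T \<psi> where T: "finite T" "\<And>g. \<psi> g \<in> M" "\<And>g. \<psi> g \<in> endomorphisms_of_degree scale C g"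
      "\<phi> = (\<Sum>g\<in>T. \<psi> g)"
    using \<phi> homogeneous_parts unfolding killing_def by blast
  have "\<psi> g x = 0" if gx: "g \<in> T" "x \<in> S" for g x
  proof -
    obtain h where h: "x \<in> C h" using S gx by blast
    have "(\<Sum>g\<in>T. \<psi> g) x \<in> {0}"
      using \<phi> gx T(4) by (simp add: killing_def)
    then show ?thesis
      using homogeneous_parts_mem[OF homogeneous_subspace_zero[OF grading] T(1,3) h] gx by blast
  qed
  then show ?thesis
    using T that[of T \<psi>] by (auto simp: killing_def)
qed

lemma killing_image_homogeneous:
  assumes S: "S \<subseteq> (\<Union>g. C g)" and u: "u \<in> C h"
  shows "homogeneous_subspace scale C ((\<lambda>\<phi>. \<phi> u) ` killing S)" (is "homogeneous_subspace _ _ ?N")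
proof (rule homogeneous_subspaceI[OF grading])
  show "subspace ?N"
    unfolding subspace_def
  proof (intro conjI ballI allI)
    show "0 \<in> ?N"
      using E.subspace_0[OF killing_subspace] by (metis (mono_tags) image_eqI zero_fun_apply)
    show "x + y \<in> ?N" if "x \<in> ?N" "y \<in> ?N" for x y
      using that E.subspace_add[OF killing_subspace]
      by auto (metis (mono_tags, lifting) image_eqI plus_fun_apply)
    show "scale c x \<in> ?N" if "x \<in> ?N" for c x
      using that E.subspace_scale[OF killing_subspace]
      by auto (metis (mono_tags, lifting) image_eqI fun_scale_def)
  qed
next
  fix x assume "x \<in> ?N"
  then obtain \<phi> where \<phi>: "\<phi> \<in> killing S" "x = \<phi> u" by blast
  obtain T \<psi> where T: "finite T" "\<And>g. g \<in> T \<Longrightarrow> \<psi> g \<in> killing S"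
      "\<And>g. \<psi> g \<in> endomorphisms_of_degree scale C g" "\<phi> = (\<Sum>g\<in>T. \<psi> g)"
    using killing_parts[OF S \<phi>(1)] by blast
  have "x = (\<Sum>g\<in>T. \<psi> g u)"
    by (simp add: \<phi>(2) T(4) sum_fun_eval)
  also have "\<dots> \<in> span (\<Union>g. ?N \<inter> C g)"
    by (intro span_sum span_base) (use T u degree_apply in fast)
  finally show "x \<in> span (\<Union>g. ?N \<inter> C g)" .
qed

lemma spanned_by_components: "span (\<Union>g. C g) = UNIV"
  using grading by (simp add: direct_sum_decomposition_def)

lemma zero_if_zero_on_components:
  assumes \<phi>: "\<phi> \<in> M" and zero: "\<And>h x. x \<in> C h \<Longrightarrow> \<phi> x = 0"
  shows "\<phi> = 0"
proof
  fix x
  have "x \<in> span (\<Union>g. C g)"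
    by (simp add: spanned_by_components)
  then show "\<phi> x = 0 x"
  proof (induction rule: span_induct)
    case base
    show ?case
      using M_linear(1,2,3)[OF \<phi>] by (simp add: subspace_def)
  qed (use zero in auto)
qed

lemma endomorphism_decomposition:
  "direct_sum_decomposition (fun_scale scale) M (\<lambda>g. M \<inter> endomorphisms_of_degree scale C g)"
  unfolding direct_sum_decomposition_def
proof (intro conjI allI impI ballI)
  show "E.subspace (M \<inter> endomorphisms_of_degree scale C g)" for g
    using M_closed(1) degree_subspace by (rule E.subspace_inter)
  show "E.span (\<Union>g. M \<inter> endomorphisms_of_degree scale C g) = M"
    using homogeneous_span by (intro antisym E.span_minimal M_closed(1)) auto
next
  fix S :: "'g set" and \<psi> g
  assume S: "finite S" and \<psi>: "\<forall>g\<in>S. \<psi> g \<in> M \<inter> endomorphisms_of_degree scale C g"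
    and sum: "(\<Sum>g\<in>S. \<psi> g) = 0" and g: "g \<in> S"
  show "\<psi> g = 0"
  proof (rule zero_if_zero_on_components)
    fix h x assume x: "x \<in> C h"
    have "(\<Sum>g\<in>S. \<psi> g x) = 0"
      using sum sum_fun_eval[of \<psi> S x] by simp
    then show "\<psi> g x = 0"
      by (rule direct_sum_independent[OF grading S, of "\<lambda>g. g + h", rotated 2])
         (use \<psi> x g in \<open>auto simp: inj_on_def intro: degree_apply\<close>)
  qed (use \<psi> g in auto)
qed

lemma graded_algebra_of_endomorphisms:
  "graded_algebra (fun_scale scale) M (\<circ>) (\<lambda>g. M \<inter> endomorphisms_of_degree scale C g)"
proof
  show "direct_sum_decomposition (fun_scale scale) M (\<lambda>g. M \<inter> endomorphisms_of_degree scale C g)"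
    by (rule endomorphism_decomposition)
  show "E.subspace M"
    by (rule M_closed)
next
  fix \<phi> \<psi> g h
  assume *: "\<phi> \<in> M \<inter> endomorphisms_of_degree scale C g" "\<psi> \<in> M \<inter> endomorphisms_of_degree scale C h"
  then have "\<phi> \<circ> \<psi> \<in> M"
    using M_closed(2) by blast
  moreover from this have "\<phi> \<circ> \<psi> \<in> endomorphisms scale"
    using subalgebra by (auto simp: endomorphism_subalgebra_def)
  moreover have "(\<phi> \<circ> \<psi>) x \<in> C (g + h + k)" if "x \<in> C k" for k x
    using * that degree_apply[of \<phi> g "\<psi> x" "h + k"] degree_apply[of \<psi> h x k] by (auto simp: add.assoc)
  ultimately show "\<phi> \<circ> \<psi> \<in> M \<inter> endomorphisms_of_degree scale C (g + h)"
    by (auto simp: endomorphisms_of_degree_def)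
qed (use M_closed(2) M_linear(1,2) in \<open>auto simp: fun_eq_iff fun_scale_def\<close>)

text \<open>
  For \<open>X = UNIV\<close> and \<open>W\<close> an ideal, or for \<open>X\<close> a submodule and \<open>W = {0}\<close>, these sets are the
  homogeneous ideals of \<open>M\<close> on which graded simplicity of \<open>M\<close> is tested.
\<close>

lemma transporter_homogeneous:
  assumes X: "homogeneous_subspace scale C X" and W: "homogeneous_subspace scale C W"
  shows "homogeneous_subspace (fun_scale scale) (\<lambda>g. M \<inter> endomorphisms_of_degree scale C g)
    {\<phi> \<in> M. \<forall>x\<in>X. \<phi> x \<in> W}" (is "homogeneous_subspace _ _ ?J")
proof (rule E.homogeneous_subspaceI[OF endomorphism_decomposition])
  have W': "subspace W"
    using W by (rule homogeneous_subspace_subspace)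
  show "E.subspace ?J"
    using M_closed(1) W' by (auto simp: E.subspace_def subspace_def) (simp_all add: fun_scale_def)
  fix \<phi> assume \<phi>: "\<phi> \<in> ?J"
  then obtain S \<psi> where S: "finite S" "\<And>g. \<psi> g \<in> M" "\<And>g. \<psi> g \<in> endomorphisms_of_degree scale C g"
      "\<phi> = (\<Sum>g\<in>S. \<psi> g)"
    using homogeneous_parts[of \<phi>] by auto
  have "\<psi> g \<in> ?J" if g: "g \<in> S" for g
  proof -
    have "\<psi> g x \<in> W" if x: "x \<in> X" for x
    proof -
      obtain T v where v: "\<And>h. v h \<in> X" "\<And>h. v h \<in> C h" "x = (\<Sum>h\<in>T. v h)"
        using homogeneous_subspace_obtain[OF X x] by metis
      have "(\<Sum>g\<in>S. \<psi> g) (v h) \<in> W" for h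
        using \<phi> v(1) S(4) by auto
      then have "\<psi> g (v h) \<in> W" for h
        using homogeneous_parts_mem[OF W S(1,3) v(2)] g by blast
      then show ?thesis
        unfolding v(3) M_linear(5)[OF S(2)] by (intro subspace_sum[OF W'])
    qed
    then show ?thesis
      using S(2) by simp
  qed
  then show "\<phi> \<in> E.span (\<Union>g. ?J \<inter> (M \<inter> endomorphisms_of_degree scale C g))"
    unfolding S(4) using S(2,3) by (intro E.span_sum E.span_base) blast
qed

end

section \<open>Density for graded irreducible modules\<close>

lemma suffix_Cons_iff:
  assumes "length t < length w"
  shows "suffix (x # t) w \<longleftrightarrow> suffix t w \<and> rev w ! length t = x"
proof -
  have take: "prefix p y \<longleftrightarrow> take (length p) y = p" for p y :: "'a list"
    by (metis append_eq_conv_conj prefix_def)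
  show ?thesis
    using assms by (simp add: suffix_to_prefix take take_Suc_conv_app_nth)
qed

locale graded_irreducible_module = graded_module scale C M
  for scale :: "'f::field \<Rightarrow> 'u::ab_group_add \<Rightarrow> 'u" and C :: "'g::ab_group_add \<Rightarrow> 'u set" and M +
  fixes V :: "'u set"
  assumes V_homogeneous: "homogeneous_subspace scale C V"
    and V_stable: "\<phi> \<in> M \<Longrightarrow> x \<in> V \<Longrightarrow> \<phi> x \<in> V"
    and irreducible: "W \<subseteq> V \<Longrightarrow> homogeneous_subspace scale C W
      \<Longrightarrow> (\<And>\<phi> x. \<phi> \<in> M \<Longrightarrow> x \<in> W \<Longrightarrow> \<phi> x \<in> W) \<Longrightarrow> W = {0} \<or> W = V"
    and nondegenerate: "x \<in> V \<Longrightarrow> (\<And>\<phi>. \<phi> \<in> M \<Longrightarrow> \<phi> x = 0) \<Longrightarrow> x = 0"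
begin

definition homogeneous_elements :: "'u set" where
  "homogeneous_elements = V \<inter> (\<Union>g. C g)"

lemma V_subspace: "subspace V"
  using V_homogeneous by (rule homogeneous_subspace_subspace)

text \<open>The image is a homogeneous submodule, so irreducibility leaves only \<open>0\<close> and \<open>V\<close>.\<close>

lemma killing_image:
  assumes S: "S \<subseteq> homogeneous_elements" and u: "u \<in> homogeneous_elements"
    and \<phi>: "\<phi> \<in> killing S" "\<phi> u \<noteq> 0"
  shows "(\<lambda>\<phi>. \<phi> u) ` killing S = V"
proof -
  let ?N = "(\<lambda>\<phi>. \<phi> u) ` killing S"
  obtain h where h: "u \<in> C h" "u \<in> V"
    using u by (auto simp: homogeneous_elements_def)
  have "?N \<subseteq> V"
    using V_stable h by (auto simp: killing_def)
  moreover have "homogeneous_subspace scale C ?N"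
    using S h by (intro killing_image_homogeneous) (auto simp: homogeneous_elements_def)
  moreover have "\<psi> x \<in> ?N" if \<psi>: "\<psi> \<in> M" and x: "x \<in> ?N" for \<psi> x
  proof -
    obtain \<chi> where \<chi>: "\<chi> \<in> killing S" "x = \<chi> u" using x by blast
    then have "\<psi> \<circ> \<chi> \<in> killing S"
      using \<psi> M_closed(2)[OF \<psi>] M_linear(3)[OF \<psi>] by (auto simp: killing_def)
    then show ?thesis
      using \<chi>(2) by (metis comp_apply image_eqI)
  qed
  ultimately have "?N = {0} \<or> ?N = V"
    using irreducible by blast
  then show ?thesis
    using \<phi> by blast
qed

text \<open>
  The condition is triangular because interpolation fixes the values one entry at a time, starting from
  the end of the list. For \<open>V = UNIV\<close> it amounts to linear independence over the centralizer.
\<close>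

fun independent_list :: "'u list \<Rightarrow> bool" where
  "independent_list [] \<longleftrightarrow> True"
| "independent_list (u # us) \<longleftrightarrow>
     u \<in> homogeneous_elements \<and> (\<exists>\<phi>\<in>killing (set us). \<phi> u \<noteq> 0) \<and> independent_list us"

lemma independent_list_homogeneous: "independent_list us \<Longrightarrow> set us \<subseteq> homogeneous_elements"
  by (induction us) auto

lemma independent_list_distinct: "independent_list us \<Longrightarrow> distinct us"
  by (induction us) (auto simp: killing_def)

lemma independent_list_nonzero:
  assumes "independent_list us" "i < length us"
  shows "us ! i \<noteq> 0"
  using assms
proof (induction us arbitrary: i)
  case (Cons u us)
  then obtain \<phi> where "\<phi> \<in> M" "\<phi> u \<noteq> 0"
    by (auto simp: killing_def)
  then have "u \<noteq> 0"
    using M_linear(3)[of \<phi>] by blast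
  with Cons show ?case
    by (cases i) auto
qed simp

text \<open>
  By irreducibility an error at one entry can be corrected without disturbing the later entries, whose
  values have been prescribed before.
\<close>

lemma interpolation:
  assumes "independent_list us" and "\<And>i. i < length us \<Longrightarrow> v i \<in> V"
  shows "\<exists>\<phi>\<in>M. \<forall>i<length us. \<phi> (us ! i) = v i"
  using assms
proof (induction us arbitrary: v)
  case Nil
  then show ?case
    using E.subspace_0[OF M_closed(1)] by (intro bexI[of _ 0]) simp_all
next
  case (Cons u us)
  obtain \<psi> where \<psi>: "\<psi> \<in> M" "\<forall>i<length us. \<psi> (us ! i) = v (Suc i)"
    using Cons.IH[of "\<lambda>i. v (Suc i)"] Cons.prems by auto
  have u: "u \<in> homogeneous_elements" and us: "set us \<subseteq> homogeneous_elements"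
    using Cons.prems independent_list_homogeneous by auto
  have "\<psi> u \<in> V" "v 0 \<in> V"
    using V_stable[OF \<psi>(1)] u Cons.prems(2)[of 0] by (auto simp: homogeneous_elements_def)
  then have "v 0 - \<psi> u \<in> V"
    using V_subspace by (auto intro: subspace_diff)
  moreover have "(\<lambda>\<phi>. \<phi> u) ` killing (set us) = V"
    using killing_image[OF us u] Cons.prems(1) by auto
  ultimately have "v 0 - \<psi> u \<in> (\<lambda>\<phi>. \<phi> u) ` killing (set us)"
    by simp
  then obtain \<chi> where \<chi>: "\<chi> \<in> killing (set us)" "\<chi> u = v 0 - \<psi> u"
    by auto
  then have "\<chi> \<in> M"
    by (simp add: killing_def)
  then have "\<psi> + \<chi> \<in> M"
    by (rule E.subspace_add[OF M_closed(1) \<psi>(1)])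
  moreover have "(\<psi> + \<chi>) ((u # us) ! i) = v i" if "i < length (u # us)" for i
    using that \<psi> \<chi> by (cases i) (auto simp: killing_def)
  ultimately show ?case
    by blast
qed

text \<open>
  The variables act on \<open>us ! 0, \<dots>, us ! d\<close> as partial shifts chosen so that only the suffixes of the
  word \<open>w\<close> move \<open>us ! 0\<close>. If \<open>w\<close> has maximal length in \<open>f\<close>, then the coefficient of \<open>us ! d\<close> in the
  value of \<open>f\<close> at \<open>us ! 0\<close> is the coefficient of \<open>w\<close>.
\<close>

lemma independent_list_length_le:
  assumes id: "f \<noteq> 0" "\<And>a. range a \<subseteq> M \<Longrightarrow> nc_poly_eval (fun_scale scale) (\<circ>) id f a = 0"
    and us: "independent_list us"
  shows "length us \<le> Max (length ` Poly_Mapping.keys f)"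
proof (rule ccontr)
  define d where "d = Max (length ` Poly_Mapping.keys f)"
  assume "\<not> length us \<le> Max (length ` Poly_Mapping.keys f)"
  then have d: "d < length us"
    by (simp add: d_def)
  have keys: "length w \<le> d" if "w \<in> Poly_Mapping.keys f" for w
    using that unfolding d_def by (intro Max_ge) auto
  have "Max (length ` Poly_Mapping.keys f) \<in> length ` Poly_Mapping.keys f"
    using id(1) by (intro Max_in) auto
  then obtain w where w: "w \<in> Poly_Mapping.keys f" "length w = d"
    by (auto simp: d_def)
  have u: "us ! i \<in> V" if "i < length us" for i
    using that independent_list_homogeneous[OF us] nth_mem by (fastforce simp: homogeneous_elements_def)
  have "\<exists>\<phi>\<in>M. \<forall>i<length us. \<phi> (us ! i) = (if i < d \<and> rev w ! i = x then us ! Suc i else 0)" for x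
    by (rule interpolation[OF us]) (use u d V_subspace in \<open>auto intro: subspace_0\<close>)
  then obtain a where a: "\<And>x. a x \<in> M"
    "\<And>x i. i < length us \<Longrightarrow> a x (us ! i) = (if i < d \<and> rev w ! i = x then us ! Suc i else 0)"
    by metis
  have shift: "foldr (\<circ>) (map a t) id (us ! 0) = (if suffix t w then us ! length t else 0)"
    if "length t \<le> d" for t
    using that
  proof (induction t)
    case (Cons x t)
    show ?case
      using Cons d w(2) M_linear(3)[OF a(1)] by (simp add: a(2) suffix_Cons_iff)
  qed auto
  \<comment> \<open>\<open>\<pi>\<close> reads off the coefficient at \<open>us ! d\<close>; words other than \<open>w\<close> do not contribute to it.\<close>
  have "\<exists>\<phi>\<in>M. \<forall>i<length us. \<phi> (us ! i) = (if i = d then us ! d else 0)"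
    by (rule interpolation[OF us]) (use u d V_subspace in \<open>auto intro: subspace_0\<close>)
  then obtain \<pi> where \<pi>: "\<pi> \<in> M" "\<And>i. i < length us \<Longrightarrow> \<pi> (us ! i) = (if i = d then us ! d else 0)"
    by blast
  have eval: "nc_poly_eval (fun_scale scale) (\<circ>) id f a = 0"
    by (rule id(2)) (use a(1) in blast)
  have "0 = \<pi> (nc_poly_eval (fun_scale scale) (\<circ>) id f a (us ! 0))"
    unfolding eval zero_fun_apply M_linear(3)[OF \<pi>(1)] ..
  also have "\<dots> = (\<Sum>t\<in>Poly_Mapping.keys f.
      scale (Poly_Mapping.lookup f t) (\<pi> (foldr (\<circ>) (map a t) id (us ! 0))))"
    unfolding nc_poly_eval_def by (simp only: sum_fun_eval fun_scale_def M_linear(2,5)[OF \<pi>(1)])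
  also have "\<dots> = (\<Sum>t\<in>Poly_Mapping.keys f. if t = w then scale (Poly_Mapping.lookup f w) (us ! d) else 0)"
  proof (rule sum.cong[OF refl])
    fix t assume t: "t \<in> Poly_Mapping.keys f"
    have "\<pi> (foldr (\<circ>) (map a t) id (us ! 0)) = (if t = w then us ! d else 0)"
    proof (cases "suffix t w")
      case True
      then obtain s where "w = s @ t"
        by (auto simp: suffix_def)
      then have "t = w \<longleftrightarrow> length t = d"
        using w(2) by auto
      then show ?thesis
        using keys[OF t] d True by (simp add: shift \<pi>(2))
    next
      case False
      then show ?thesis
        using keys[OF t] M_linear(3)[OF \<pi>(1)] by (auto simp: shift)
    qed
    then show "scale (Poly_Mapping.lookup f t) (\<pi> (foldr (\<circ>) (map a t) id (us ! 0)))
        = (if t = w then scale (Poly_Mapping.lookup f w) (us ! d) else 0)"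
      by auto
  qed
  also have "\<dots> = scale (Poly_Mapping.lookup f w) (us ! d)"
    using w(1) by simp
  finally show False
    using w(1) independent_list_nonzero[OF us d] by (simp add: in_keys_iff)
qed

text \<open>A longest independent list cannot be extended, which says that its killers kill all of \<open>V\<close>.\<close>

lemma exists_complete_list:
  assumes "satisfies_polynomial_identity (fun_scale scale) M (\<circ>) id"
  obtains us where "independent_list us" "\<And>\<phi> x. \<phi> \<in> killing (set us) \<Longrightarrow> x \<in> V \<Longrightarrow> \<phi> x = 0"
proof -
  obtain f where f: "f \<noteq> 0" "\<And>a. range a \<subseteq> M \<Longrightarrow> nc_poly_eval (fun_scale scale) (\<circ>) id f a = 0"
    using assms unfolding satisfies_polynomial_identity_def by blast
  have "independent_list us \<Longrightarrow> length us < Suc (Max (length ` Poly_Mapping.keys f))" for us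
    using independent_list_length_le[OF f] by (simp add: less_Suc_eq_le)
  then obtain us where us: "independent_list us" "\<And>vs. independent_list vs \<Longrightarrow> length vs \<le> length us"
    using ex_has_greatest_nat[of independent_list "[]" length] by (metis independent_list.simps(1))
  have "\<phi> x = 0" if \<phi>: "\<phi> \<in> killing (set us)" and x: "x \<in> V" for \<phi> x
  proof -
    have kill: "\<phi> y = 0" if "y \<in> homogeneous_elements" for y
      using us(1) us(2)[of "y # us"] \<phi> that by auto
    obtain S v where v: "\<And>g. v g \<in> V" "\<And>g. v g \<in> C g" "x = (\<Sum>g\<in>S. v g)"
      using homogeneous_subspace_obtain[OF V_homogeneous x] by metis
    have "\<phi> (v g) = 0" for g
      using v(1,2)[of g] by (intro kill) (auto simp: homogeneous_elements_def)
    then show ?thesis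
      using \<phi> by (simp add: v(3) M_linear(5) killing_def)
  qed
  with us(1) show ?thesis by (rule that)
qed

text \<open>
  An element \<open>e\<close> fixing a complete list is the identity on \<open>V\<close> because every \<open>m e - m\<close> kills the
  list and hence vanishes on \<open>V\<close>, so that \<open>e x - x\<close> is killed by \<open>M\<close>.
\<close>

lemma exists_identity:
  assumes "satisfies_polynomial_identity (fun_scale scale) M (\<circ>) id"
  obtains e where "e \<in> M" "\<And>x. x \<in> V \<Longrightarrow> e x = x"
proof -
  obtain us where us: "independent_list us" "\<And>\<phi> x. \<phi> \<in> killing (set us) \<Longrightarrow> x \<in> V \<Longrightarrow> \<phi> x = 0"
    using exists_complete_list[OF assms] by metis
  have "us ! i \<in> V" if "i < length us" for i
    using that independent_list_homogeneous[OF us(1)] nth_mem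
    by (fastforce simp: homogeneous_elements_def)
  then obtain e where e: "e \<in> M" "\<forall>i<length us. e (us ! i) = us ! i"
    using interpolation[OF us(1), of "\<lambda>i. us ! i"] by blast
  have "e x = x" if x: "x \<in> V" for x
  proof -
    have "m (e x - x) = 0" if m: "m \<in> M" for m
    proof -
      have "(m \<circ> e) - m \<in> M"
        using m e(1) by (intro E.subspace_diff[OF M_closed(1)] M_closed(2))
      then have "(m \<circ> e) - m \<in> killing (set us)"
        using e(2) by (auto simp: killing_def in_set_conv_nth)
      from us(2)[OF this x] show ?thesis
        using M_linear(4)[OF m] by simp
    qed
    moreover have "e x - x \<in> V"
      using x V_stable[OF e(1)] V_subspace by (auto intro: subspace_diff)
    ultimately show ?thesis
      using nondegenerate[of "e x - x"] by auto
  qed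
  with e(1) show ?thesis by (rule that)
qed

end

section \<open>The centralizer of an irreducible module\<close>

context graded_module
begin

text \<open>For the multiplication algebra this is the graded centroid.\<close>

definition centralizer :: "('u \<Rightarrow> 'u) set" where
  "centralizer = E.span (\<Union>g. endomorphisms_over scale M \<inter> endomorphisms_of_degree scale C g)"

lemma endomorphisms_over_subspace: "E.subspace (endomorphisms_over scale M)"
  unfolding E.subspace_def endomorphisms_over_def
  by (auto simp: endomorphisms_iff fun_scale_def algebra_simps scale_left_commute M_linear)

lemma centralizer_subset: "centralizer \<subseteq> endomorphisms_over scale M"
  unfolding centralizer_def by (intro E.span_minimal endomorphisms_over_subspace) blast

lemma centralizer_commute: "\<gamma> \<in> centralizer \<Longrightarrow> \<phi> \<in> M \<Longrightarrow> \<gamma> (\<phi> x) = \<phi> (\<gamma> x)"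
  using centralizer_subset by (auto simp: endomorphisms_over_def)

lemma centralizer_subspace: "E.subspace centralizer"
  by (simp add: centralizer_def E.subspace_span)

end

locale graded_irreducible_space = graded_irreducible_module scale C M UNIV
  for scale :: "'f::field \<Rightarrow> 'u::ab_group_add \<Rightarrow> 'u" and C :: "'g::ab_group_add \<Rightarrow> 'u set" and M
begin

text \<open>
  Graded double annihilator property. If the elements of \<open>M\<close> killing \<open>S\<close> carry \<open>a\<close> to all of the
  space, then \<open>\<psi> a \<mapsto> \<psi> u\<close>, for \<open>\<psi>\<close> killing \<open>S\<close>, is well defined as soon as \<open>u\<close> is killed by
  everything that kills \<open>insert a S\<close>. It is a homogeneous element \<open>\<gamma>\<close> of the centralizer, and
  \<open>u - \<gamma> a\<close> is killed by everything that kills \<open>S\<close>.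
\<close>

lemma double_annihilator:
  assumes "finite S" "S \<subseteq> (\<Union>g. C g)" "u \<in> C k" "\<And>\<phi>. \<phi> \<in> killing S \<Longrightarrow> \<phi> u = 0"
  shows "\<exists>\<gamma>. (\<forall>b\<in>S. \<gamma> b \<in> centralizer) \<and> u = (\<Sum>b\<in>S. \<gamma> b b)"
  using assms
proof (induction S arbitrary: u rule: finite_induct)
  case empty
  then have "u = 0"
    using nondegenerate[of u] by (auto simp: killing_def)
  then show ?case by simp
next
  case (insert a S)
  have S: "S \<subseteq> homogeneous_elements" and a: "a \<in> homogeneous_elements"
    using insert.prems by (auto simp: homogeneous_elements_def)
  show ?case
  proof (cases "\<exists>\<phi>\<in>killing S. \<phi> a \<noteq> 0")
    case False
    then have "killing S \<subseteq> killing (insert a S)"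
      by (auto simp: killing_def)
    then have "\<exists>\<gamma>. (\<forall>b\<in>S. \<gamma> b \<in> centralizer) \<and> u = (\<Sum>b\<in>S. \<gamma> b b)"
      using insert.prems by (intro insert.IH) auto
    then obtain \<gamma> where \<gamma>: "\<forall>b\<in>S. \<gamma> b \<in> centralizer" "u = (\<Sum>b\<in>S. \<gamma> b b)"
      by blast
    have "(\<Sum>b\<in>S. (\<gamma>(a := 0)) b b) = (\<Sum>b\<in>S. \<gamma> b b)"
      using insert.hyps by (intro sum.cong) auto
    then show ?thesis
      using \<gamma> insert.hyps E.subspace_0[OF centralizer_subspace]
      by (intro exI[of _ "\<gamma>(a := 0)"]) auto
  next
    case True
    then have surj: "(\<lambda>\<phi>. \<phi> a) ` killing S = UNIV"
      using killing_image[OF S a] by blast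
    obtain l where l: "a \<in> C l"
      using insert.prems by blast
    define \<gamma> where "\<gamma> x = (SOME \<psi>. \<psi> \<in> killing S \<and> \<psi> a = x) u" for x
    have \<gamma>: "\<gamma> (\<psi> a) = \<psi> u" if \<psi>: "\<psi> \<in> killing S" for \<psi>
    proof -
      define \<chi> where "\<chi> = (SOME \<chi>. \<chi> \<in> killing S \<and> \<chi> a = \<psi> a)"
      have \<chi>: "\<chi> \<in> killing S \<and> \<chi> a = \<psi> a"
        unfolding \<chi>_def by (rule someI[of _ \<psi>]) (simp add: \<psi>)
      then have "\<chi> - \<psi> \<in> killing S"
        using \<psi> by (intro E.subspace_diff[OF killing_subspace]) auto
      then have "\<chi> - \<psi> \<in> killing (insert a S)"
        using \<chi> by (auto simp: killing_def)
      from insert.prems(3)[OF this] show ?thesis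
        by (simp add: \<gamma>_def \<chi>_def)
    qed
    have pre: "\<exists>\<psi>\<in>killing S. x = \<psi> a" for x
      using surj by (metis UNIV_I imageE)
    have "\<gamma> \<in> endomorphisms scale"
      unfolding endomorphisms_iff
    proof (intro conjI allI)
      fix x y
      obtain \<psi> \<chi> where *: "\<psi> \<in> killing S" "x = \<psi> a" "\<chi> \<in> killing S" "y = \<chi> a"
        using pre by metis
      with \<gamma>[OF E.subspace_add[OF killing_subspace *(1,3)]] show "\<gamma> (x + y) = \<gamma> x + \<gamma> y"
        by (simp add: \<gamma>)
    next
      fix c x
      obtain \<psi> where *: "\<psi> \<in> killing S" "x = \<psi> a"
        using pre by metis
      with \<gamma>[OF E.subspace_scale[OF killing_subspace *(1), of c]] show "\<gamma> (scale c x) = scale c (\<gamma> x)"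
        by (simp add: \<gamma> fun_scale_def)
    qed
    moreover have "\<gamma> (\<phi> x) = \<phi> (\<gamma> x)" if \<phi>: "\<phi> \<in> M" for \<phi> x
    proof -
      obtain \<psi> where *: "\<psi> \<in> killing S" "x = \<psi> a"
        using pre by metis
      then have "\<phi> \<circ> \<psi> \<in> killing S"
        using M_closed(2)[OF \<phi>] M_linear(3)[OF \<phi>] by (auto simp: killing_def)
      from \<gamma>[OF this] show ?thesis
        by (simp add: * \<gamma>)
    qed
    moreover have deg: "\<gamma> x \<in> C (k - l + h)" if x: "x \<in> C h" for h x
    proof -
      obtain \<psi> where \<psi>: "\<psi> \<in> killing S" "x = \<psi> a"
        using pre by metis
      obtain T \<chi> where T: "finite T" "\<And>g. g \<in> T \<Longrightarrow> \<chi> g \<in> killing S"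
          "\<And>g. \<chi> g \<in> endomorphisms_of_degree scale C g" "\<psi> = (\<Sum>g\<in>T. \<chi> g)"
        using killing_parts[OF _ \<psi>(1)] insert.prems(1) by (metis insert_subset)
      have "\<chi> g u \<in> C (k - l + h)" if g: "g \<in> T" for g
      \<comment> \<open>As \<open>\<psi> a = x\<close> has degree \<open>h\<close>, all components of \<open>\<psi>\<close> in degrees other than \<open>h - l\<close> kill \<open>a\<close>.\<close>
      proof (cases "g = h - l")
        case True
        then have eq: "g + k = k - l + h"
          by (simp add: algebra_simps)
        show ?thesis
          using degree_apply[OF T(3)[of g] insert.prems(2)] unfolding eq .
      next
        case False
        have "(\<Sum>g\<in>T. \<chi> g) a \<in> C h"
          using x \<psi>(2) T(4) by simp
        then have "\<chi> g a \<in> C h"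
          by (rule homogeneous_parts_mem[OF component_homogeneous T(1,3) l _ g])
        moreover have "\<chi> g a \<in> C (g + l)"
          using T(3) l by (rule degree_apply)
        ultimately have "\<chi> g a = 0"
          using components_disjoint False by (metis add_diff_cancel)
        then have "\<chi> g u = \<gamma> 0"
          using \<gamma>[OF T(2)[OF g]] by simp
        also have "\<dots> = 0"
          using \<gamma>[OF E.subspace_0[OF killing_subspace]] by simp
        finally show ?thesis
          using component_subspace by (simp add: subspace_0)
      qed
      then have "\<psi> u \<in> C (k - l + h)"
        unfolding T(4) sum_fun_eval by (intro subspace_sum component_subspace)
      then show ?thesis
        using \<gamma>[OF \<psi>(1)] \<psi>(2) by simp
    qed
    ultimately have \<gamma>_cent: "\<gamma> \<in> centralizer"
      unfolding centralizer_def
      by (intro E.span_base UN_I[of "k - l"])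
         (auto simp: endomorphisms_over_def endomorphisms_of_degree_def)
    have "u - \<gamma> a \<in> C k"
      using deg[OF l] insert.prems(2) component_subspace by (auto intro: subspace_diff)
    moreover have "\<psi> (u - \<gamma> a) = 0" if \<psi>: "\<psi> \<in> killing S" for \<psi>
      using \<psi> \<gamma>[OF \<psi>] centralizer_commute[OF \<gamma>_cent, of \<psi> a] M_linear(4)[of \<psi>]
      by (simp add: killing_def)
    ultimately obtain \<delta> where \<delta>: "\<forall>b\<in>S. \<delta> b \<in> centralizer" "u - \<gamma> a = (\<Sum>b\<in>S. \<delta> b b)"
      using insert.IH[of "u - \<gamma> a"] insert.prems(1) by auto
    have "(\<Sum>b\<in>S. (\<delta>(a := \<gamma>)) b b) = (\<Sum>b\<in>S. \<delta> b b)"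
      using insert.hyps by (intro sum.cong) auto
    then have "u = (\<Sum>b\<in>insert a S. (\<delta>(a := \<gamma>)) b b)"
      using insert.hyps \<delta>(2) by (simp add: algebra_simps)
    then show ?thesis
      using \<delta>(1) \<gamma>_cent by (intro exI[of _ "\<delta>(a := \<gamma>)"]) auto
  qed
qed

end

context graded_irreducible_space
begin

lemma exists_complete_spanning_list:
  assumes "satisfies_polynomial_identity (fun_scale scale) M (\<circ>) id"
  obtains us where "independent_list us"
    "\<And>u. \<exists>\<gamma>. (\<forall>b\<in>set us. \<gamma> b \<in> centralizer) \<and> u = (\<Sum>b\<in>set us. \<gamma> b b)"
proof -
  obtain us where us: "independent_list us" "\<And>\<phi> x. \<phi> \<in> killing (set us) \<Longrightarrow> \<phi> x = 0"
    using exists_complete_list[OF assms] by (metis UNIV_I)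
  have hom: "set us \<subseteq> (\<Union>g. C g)"
    using independent_list_homogeneous[OF us(1)] by (auto simp: homogeneous_elements_def)
  have "\<exists>\<gamma>. (\<forall>b\<in>set us. \<gamma> b \<in> centralizer) \<and> u = (\<Sum>b\<in>set us. \<gamma> b b)" for u
  proof -
    obtain S v where v: "\<And>g. v g \<in> C g" "u = (\<Sum>g\<in>S. v g)"
      using homogeneous_subspace_obtain[OF V_homogeneous UNIV_I] by metis
    have "\<exists>\<gamma>. (\<forall>b\<in>set us. \<gamma> b \<in> centralizer) \<and> v g = (\<Sum>b\<in>set us. \<gamma> b b)" for g
      using double_annihilator[OF finite_set hom v(1)] us(2) by blast
    then obtain \<gamma> where \<gamma>: "\<And>g b. b \<in> set us \<Longrightarrow> \<gamma> g b \<in> centralizer" "\<And>g. v g = (\<Sum>b\<in>set us. \<gamma> g b b)"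
      by metis
    have "(\<Sum>g\<in>S. \<gamma> g b) \<in> centralizer" if "b \<in> set us" for b
      using \<gamma>(1) that by (intro E.subspace_sum centralizer_subspace)
    moreover have "u = (\<Sum>b\<in>set us. (\<Sum>g\<in>S. \<gamma> g b) b)"
      unfolding v(2) \<gamma>(2) sum_fun_eval by (rule sum.swap)
    ultimately show ?thesis
      by (intro exI[of _ "\<lambda>b. \<Sum>g\<in>S. \<gamma> g b"]) blast
  qed
  with us(1) show ?thesis by (rule that)
qed

text \<open>
  An element of \<open>M\<close> sending \<open>b\<close> to \<open>x\<close> and the other entries to \<open>0\<close> commutes with the coefficients, so
  it turns a relation into \<open>\<gamma> b x = 0\<close>.
\<close>

lemma independent_list_independent_over_centralizer:
  assumes us: "independent_list us" and S: "S \<subseteq> set us"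
    and \<gamma>: "\<And>b. b \<in> S \<Longrightarrow> \<gamma> b \<in> centralizer" "(\<Sum>b\<in>S. \<gamma> b b) = 0" and b: "b \<in> S"
  shows "\<gamma> b = 0"
proof
  fix x
  obtain i where i: "i < length us" "us ! i = b"
    using S b by (metis in_set_conv_nth subsetD)
  obtain \<phi> where \<phi>: "\<phi> \<in> M" "\<forall>j<length us. \<phi> (us ! j) = (if j = i then x else 0)"
    using interpolation[OF us, of "\<lambda>j. if j = i then x else 0"] by auto
  have \<phi>': "\<phi> c = (if c = b then x else 0)" if "c \<in> set us" for c
    using \<phi>(2) i that independent_list_distinct[OF us] by (auto simp: in_set_conv_nth nth_eq_iff_index_eq)
  have \<gamma>0: "\<gamma> c 0 = 0" if "c \<in> S" for c
    using centralizer_commute[OF \<gamma>(1)[OF that] E.subspace_0[OF M_closed(1)], of 0] by simp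
  have "0 = \<phi> (\<Sum>b\<in>S. \<gamma> b b)"
    using \<gamma>(2) M_linear(3)[OF \<phi>(1)] by simp
  also have "\<dots> = (\<Sum>c\<in>S. \<gamma> c (\<phi> c))"
    unfolding M_linear(5)[OF \<phi>(1)] by (intro sum.cong refl) (simp add: centralizer_commute[OF \<gamma>(1) \<phi>(1)])
  also have "\<dots> = (\<Sum>c\<in>S. if c = b then \<gamma> b x else 0)"
    using \<phi>' S \<gamma>0 by (intro sum.cong refl) auto
  also have "\<dots> = \<gamma> b x"
    using b finite_subset[OF S] by simp
  finally show "\<gamma> b x = 0 x"
    by simp
qed

lemma finite_graded_basis:
  assumes "satisfies_polynomial_identity (fun_scale scale) M (\<circ>) id"
  obtains us where "independent_list us" "graded_basis centralizer C (set us)"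
proof -
  obtain us where us: "independent_list us"
      "\<And>u. \<exists>\<gamma>. (\<forall>b\<in>set us. \<gamma> b \<in> centralizer) \<and> u = (\<Sum>b\<in>set us. \<gamma> b b)"
    using exists_complete_spanning_list[OF assms] by metis
  have "graded_basis centralizer C (set us)"
    unfolding graded_basis_def
  proof (intro conjI allI impI)
    show "set us \<subseteq> (\<Union>g. C g)"
      using independent_list_homogeneous[OF us(1)] by (auto simp: homogeneous_elements_def)
    show "\<forall>b\<in>S. \<gamma> b = 0"
      if "S \<subseteq> set us" "\<forall>b\<in>S. \<gamma> b \<in> centralizer" "(\<Sum>b\<in>S. \<gamma> b b) = 0" for S \<gamma>
      using independent_list_independent_over_centralizer[OF us(1)] that by blast
    show "\<exists>S \<gamma>. finite S \<and> S \<subseteq> set us \<and> (\<forall>b\<in>S. \<gamma> b \<in> centralizer) \<and> u = (\<Sum>b\<in>S. \<gamma> b b)" for u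
      using us(2)[of u] by blast
  qed
  with us(1) show ?thesis by (rule that)
qed

lemma eq_if_eq_on_basis:
  assumes B: "graded_basis centralizer C B"
    and \<theta>: "\<theta> \<in> endomorphisms_over scale centralizer" and \<eta>: "\<eta> \<in> endomorphisms_over scale centralizer"
    and eq: "\<And>b. b \<in> B \<Longrightarrow> \<theta> b = \<eta> b"
  shows "\<theta> = \<eta>"
proof
  fix x
  obtain S \<gamma> where S: "S \<subseteq> B" "\<forall>b\<in>S. \<gamma> b \<in> centralizer" "x = (\<Sum>b\<in>S. \<gamma> b b)"
    using B unfolding graded_basis_def by metis
  have *: "\<zeta> x = (\<Sum>b\<in>S. \<gamma> b (\<zeta> b))" if \<zeta>: "\<zeta> \<in> endomorphisms_over scale centralizer" for \<zeta>
  proof -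
    interpret Vector_Spaces.linear scale scale \<zeta>
      using \<zeta> by (simp add: endomorphisms_over_def endomorphisms_def)
    show ?thesis
      using \<zeta> S(2) by (simp add: S(3) sum endomorphisms_over_def)
  qed
  show "\<theta> x = \<eta> x"
    unfolding *[OF \<theta>] *[OF \<eta>] using S(1) eq by (intro sum.cong) auto
qed

lemma subset_double_centralizer: "M \<subseteq> endomorphisms_over scale centralizer"
  using subalgebra centralizer_commute
  by (auto simp: endomorphisms_over_def endomorphism_subalgebra_def)

text \<open>Interpolation on a basis reaches every map that is linear over the centralizer.\<close>

lemma double_centralizer:
  assumes "satisfies_polynomial_identity (fun_scale scale) M (\<circ>) id"
  shows "endomorphisms_over scale centralizer = M"
proof
  obtain us where us: "independent_list us" "graded_basis centralizer C (set us)"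
    using finite_graded_basis[OF assms] by metis
  show "endomorphisms_over scale centralizer \<subseteq> M"
  proof
    fix \<theta> assume \<theta>: "\<theta> \<in> endomorphisms_over scale centralizer"
    obtain \<phi> where \<phi>: "\<phi> \<in> M" "\<forall>i<length us. \<phi> (us ! i) = \<theta> (us ! i)"
      using interpolation[OF us(1), of "\<lambda>i. \<theta> (us ! i)"] by auto
    have "\<theta> = \<phi>"
      by (rule eq_if_eq_on_basis[OF us(2) \<theta>])
         (use \<phi> subset_double_centralizer in \<open>auto simp: in_set_conv_nth\<close>)
    with \<phi>(1) show "\<theta> \<in> M" by simp
  qed
qed (rule subset_double_centralizer)

text \<open>
  This is the simplicity of a matrix algebra: a nonzero homogeneous \<open>\<phi>\<close> in an ideal moves some basis
  element \<open>b\<close> to a nonzero homogeneous vector, which \<open>M\<close> can carry anywhere, and composing on the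
  right with maps supported on a single basis element isolates the summands of any element of \<open>M\<close>.
\<close>

lemma graded_simple_of_endomorphisms:
  assumes PI: "satisfies_polynomial_identity (fun_scale scale) M (\<circ>) id"
    and nonzero: "(UNIV :: 'u set) \<noteq> {0}"
  shows "graded_simple_algebra (fun_scale scale) M (\<circ>) (\<lambda>g. M \<inter> endomorphisms_of_degree scale C g)"
proof -
  interpret A: graded_algebra "fun_scale scale" M "(\<circ>)" "\<lambda>g. M \<inter> endomorphisms_of_degree scale C g"
    by (rule graded_algebra_of_endomorphisms)
  obtain us where us: "independent_list us" "graded_basis centralizer C (set us)"
    using finite_graded_basis[OF PI] by metis
  obtain e where e: "e \<in> M" "\<And>x. e x = x"
    using exists_identity[OF PI] by (metis UNIV_I)
  obtain x0 :: 'u where x0: "x0 \<noteq> 0"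
    using nonzero by blast
  show ?thesis
  proof
    have "e \<circ> e \<in> E.span {\<phi> \<circ> \<psi> |\<phi> \<psi>. \<phi> \<in> M \<and> \<psi> \<in> M}"
      using e(1) by (intro E.span_base) blast
    moreover have "(e \<circ> e) x0 \<noteq> 0"
      using x0 e(2) by simp
    ultimately show "E.span {\<phi> \<circ> \<psi> |\<phi> \<psi>. \<phi> \<in> M \<and> \<psi> \<in> M} \<noteq> {0}"
      by (metis singletonD zero_fun_apply)
  next
    fix J assume J: "two_sided_ideal (fun_scale scale) M (\<circ>) J"
      and hom: "homogeneous_subspace (fun_scale scale) (\<lambda>g. M \<inter> endomorphisms_of_degree scale C g) J"
    have J_sub: "E.subspace J" "J \<subseteq> M" and J_mult: "\<And>\<phi> \<psi>. \<phi> \<in> M \<Longrightarrow> \<psi> \<in> J \<Longrightarrow> \<phi> \<circ> \<psi> \<in> J"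
        "\<And>\<phi> \<psi>. \<phi> \<in> M \<Longrightarrow> \<psi> \<in> J \<Longrightarrow> \<psi> \<circ> \<phi> \<in> J"
      using J by (auto simp: two_sided_ideal_def)
    have "J = M" if J_nonzero: "J \<noteq> {0}"
    proof -
      obtain \<phi>0 where \<phi>0: "\<phi>0 \<in> J" "\<phi>0 \<noteq> 0"
        using J_nonzero E.subspace_0[OF J_sub(1)] by auto
      obtain S \<psi> where \<psi>: "\<And>g. \<psi> g \<in> J" "\<And>g. \<psi> g \<in> M \<inter> endomorphisms_of_degree scale C g"
          "\<phi>0 = (\<Sum>g\<in>S. \<psi> g)"
        by (rule E.homogeneous_subspace_obtain[OF hom \<phi>0(1)]) (rule that)
      obtain g where g: "\<psi> g \<noteq> 0"
        using \<phi>0(2) \<psi>(3) by (metis sum.neutral)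
      define \<phi> where "\<phi> = \<psi> g"
      have \<phi>: "\<phi> \<in> J" "\<phi> \<in> M" "\<phi> \<in> endomorphisms_of_degree scale C g" "\<phi> \<noteq> 0"
        using \<psi>(1,2)[of g] g by (simp_all add: \<phi>_def)
      have "\<exists>b\<in>set us. \<phi> b \<noteq> 0"
      proof (rule ccontr)
        assume "\<not> ?thesis"
        then have "\<phi> = 0"
          using subset_double_centralizer \<phi>(2) E.subspace_0[OF M_closed(1)]
          by (intro eq_if_eq_on_basis[OF us(2)]) auto
        with \<phi>(4) show False by simp
      qed
      then obtain b where b: "b \<in> set us" "\<phi> b \<noteq> 0"
        by blast
      then obtain h where h: "b \<in> C h"
        using us(2)[unfolded graded_basis_def, THEN conjunct1] by blast
      have \<phi>b: "\<phi> b \<in> homogeneous_elements"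
        using degree_apply[OF \<phi>(3) h] by (auto simp: homogeneous_elements_def)
      have surj: "(\<lambda>\<psi>. \<psi> (\<phi> b)) ` killing {} = UNIV"
        by (rule killing_image[OF _ \<phi>b, of _ e]) (use e b(2) in \<open>auto simp: killing_def\<close>)
      \<comment> \<open>The maps sending one basis element to an arbitrary vector and the others to \<open>0\<close> play the role of matrix units.\<close>
      have elementary: "\<exists>\<chi>\<in>J. \<forall>j<length us. \<chi> (us ! j) = (if j = i then v else 0)" for i v
      proof -
        obtain \<epsilon> where \<epsilon>: "\<epsilon> \<in> M" "\<forall>j<length us. \<epsilon> (us ! j) = (if j = i then b else 0)"
          using interpolation[OF us(1), of "\<lambda>j. if j = i then b else 0"] by auto
        have "v \<in> (\<lambda>\<psi>. \<psi> (\<phi> b)) ` killing {}"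
          using surj by simp
        then obtain \<psi> where \<psi>: "\<psi> \<in> M" "\<psi> (\<phi> b) = v"
          by (auto simp: killing_def)
        have "\<psi> \<circ> (\<phi> \<circ> \<epsilon>) \<in> J"
          using J_mult \<epsilon>(1) \<psi>(1) \<phi>(1) by simp
        then show ?thesis
          using \<epsilon>(2) \<psi>(2) M_linear(3)[OF \<psi>(1)] M_linear(3)[OF \<phi>(2)]
          by (intro bexI[of _ "\<psi> \<circ> (\<phi> \<circ> \<epsilon>)"]) auto
      qed
      have "\<theta> \<in> J" if \<theta>: "\<theta> \<in> M" for \<theta>
      proof -
        have "\<forall>i. \<exists>\<chi>. \<chi> \<in> J \<and> (\<forall>j<length us. \<chi> (us ! j) = (if j = i then \<theta> (us ! i) else 0))"
          using elementary by (auto simp: Bex_def)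
        from choice[OF this] obtain \<chi> where "\<forall>i. \<chi> i \<in> J \<and>
            (\<forall>j<length us. \<chi> i (us ! j) = (if j = i then \<theta> (us ! i) else 0))" ..
        then have \<chi>: "\<chi> i \<in> J" "j < length us \<Longrightarrow> \<chi> i (us ! j) = (if j = i then \<theta> (us ! i) else 0)" for i j
          by simp_all
        have sum: "(\<Sum>i<length us. \<chi> i) \<in> J"
          using \<chi>(1) by (intro E.subspace_sum J_sub(1))
        have "\<theta> = (\<Sum>i<length us. \<chi> i)"
        proof (rule eq_if_eq_on_basis[OF us(2)])
          fix b assume "b \<in> set us"
          then show "\<theta> b = (\<Sum>i<length us. \<chi> i) b"
            by (auto simp: in_set_conv_nth sum_fun_eval \<chi>(2))
        qed (use \<theta> sum J_sub(2) subset_double_centralizer in auto)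
        with sum show ?thesis by simp
      qed
      with J_sub(2) show ?thesis by blast
    qed
    then show "J = {0} \<or> J = M" by blast
  qed
qed

end

section \<open>The multiplication algebra\<close>

locale full_graded_algebra = graded_algebra scale UNIV mult U
  for scale :: "'f::field \<Rightarrow> 'u::ab_group_add \<Rightarrow> 'u" and mult and U :: "'g::ab_group_add \<Rightarrow> 'u set"
begin

sublocale End: vector_space "fun_scale scale"
  by (rule vector_space_fun_scale) (rule vector_space_axioms)

abbreviation MA :: "('u \<Rightarrow> 'u) set" where
  "MA \<equiv> multiplication_algebra scale mult"

abbreviation multiplications :: "('u \<Rightarrow> 'u) set" where
  "multiplications \<equiv> range (\<lambda>a x. mult a x) \<union> range (\<lambda>a x. mult x a)"

lemma multiplications_subset: "multiplications \<subseteq> endomorphisms scale"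
  using mult_add_left mult_add_right mult_scale_left mult_scale_right
  by (auto simp: endomorphisms_iff)

lemma endomorphism_zero: "\<phi> \<in> endomorphisms scale \<Longrightarrow> \<phi> 0 = 0"
  by (metis endomorphisms_iff scale_zero_left)

lemma endomorphism_subalgebra_endomorphisms: "endomorphism_subalgebra scale (endomorphisms scale)"
  by (auto simp: endomorphism_subalgebra_def End.subspace_def endomorphisms_iff fun_scale_def
      algebra_simps scale_left_commute)

lemma MA_subalgebra: "endomorphism_subalgebra scale MA"
  unfolding multiplication_algebra_def hull_def
  using multiplications_subset endomorphism_subalgebra_endomorphisms
  by (auto simp: endomorphism_subalgebra_def intro!: End.subspace_Inter)

lemma MA_minimal:
  "endomorphism_subalgebra scale T \<Longrightarrow> multiplications \<subseteq> T \<Longrightarrow> MA \<subseteq> T"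
  unfolding multiplication_algebra_def by (rule hull_minimal)

lemma mult_in_MA: "(\<lambda>x. mult a x) \<in> MA" "(\<lambda>x. mult x a) \<in> MA"
  unfolding multiplication_algebra_def by (rule hull_inc; blast)+

lemma MA_stable:
  assumes W: "subspace W" and stable: "\<And>a x. x \<in> W \<Longrightarrow> mult a x \<in> W \<and> mult x a \<in> W"
    and \<phi>: "\<phi> \<in> MA" and x: "x \<in> W"
  shows "\<phi> x \<in> W"
proof -
  have "endomorphism_subalgebra scale {\<phi> \<in> endomorphisms scale. \<forall>x\<in>W. \<phi> x \<in> W}"
    using endomorphism_subalgebra_endomorphisms W
    by (auto simp: endomorphism_subalgebra_def End.subspace_def subspace_def) (simp_all add: fun_scale_def)
  then have "MA \<subseteq> {\<phi> \<in> endomorphisms scale. \<forall>x\<in>W. \<phi> x \<in> W}"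
    by (rule MA_minimal) (use multiplications_subset stable in auto)
  then show ?thesis
    using \<phi> x by blast
qed

lemma annihilator_iff: "x \<in> annihilator mult \<longleftrightarrow> (\<forall>\<phi>\<in>MA. \<phi> x = 0)"
proof
  assume x: "x \<in> annihilator mult"
  have "endomorphism_subalgebra scale {\<phi> \<in> endomorphisms scale. \<phi> x = 0}"
    using endomorphism_subalgebra_endomorphisms
    by (auto simp: endomorphism_subalgebra_def End.subspace_def)
      (simp_all add: fun_scale_def endomorphism_zero)
  then have "MA \<subseteq> {\<phi> \<in> endomorphisms scale. \<phi> x = 0}"
    by (rule MA_minimal) (use multiplications_subset x in \<open>auto simp: annihilator_def\<close>)
  then show "\<forall>\<phi>\<in>MA. \<phi> x = 0"
    by blast
next
  assume *: "\<forall>\<phi>\<in>MA. \<phi> x = 0"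
  show "x \<in> annihilator mult"
    using *[THEN bspec, OF mult_in_MA(1)] *[THEN bspec, OF mult_in_MA(2)] by (simp add: annihilator_def)
qed

lemma annihilator_eq: "annihilator mult = {x. \<forall>\<phi>\<in>MA. \<phi> x = 0}"
  using annihilator_iff by blast

lemma two_sided_ideal_iff:
  "two_sided_ideal scale UNIV mult I \<longleftrightarrow> subspace I \<and> (\<forall>\<phi>\<in>MA. \<forall>x\<in>I. \<phi> x \<in> I)"
proof
  assume "subspace I \<and> (\<forall>\<phi>\<in>MA. \<forall>x\<in>I. \<phi> x \<in> I)"
  then show "two_sided_ideal scale UNIV mult I"
    unfolding two_sided_ideal_def using mult_in_MA by fast
qed (auto simp: two_sided_ideal_def intro: MA_stable)

text \<open>
  Multiplication by a homogeneous element is homogeneous; for right multiplications this uses that the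
  group is commutative. The span of the homogeneous elements of \<open>MA\<close> is closed under composition and
  contains all multiplications, so it exhausts \<open>MA\<close>.
\<close>

sublocale module: graded_module scale U MA
proof
  show "direct_sum_decomposition scale UNIV U"
    by (rule grading)
  show "endomorphism_subalgebra scale MA"
    by (rule MA_subalgebra)
  have U_span: "a \<in> span (\<Union>g. U g)" for a
    using grading by (simp add: direct_sum_decomposition_def)
  define G where "G = (\<Union>g. MA \<inter> endomorphisms_of_degree scale U g)"
  have G_subset: "G \<subseteq> MA"
    by (auto simp: G_def)
  have span_subset: "End.span G \<subseteq> MA"
    using G_subset MA_subalgebra by (intro End.span_minimal) (auto simp: endomorphism_subalgebra_def)
  have endo: "\<phi> \<in> endomorphisms scale" if "\<phi> \<in> MA" for \<phi>
    using that MA_subalgebra by (auto simp: endomorphism_subalgebra_def)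
  have comp_G: "\<phi> \<circ> \<psi> \<in> G" if \<phi>: "\<phi> \<in> G" and \<psi>: "\<psi> \<in> G" for \<phi> \<psi>
  proof -
    obtain g h where gh: "\<phi> \<in> endomorphisms_of_degree scale U g" "\<psi> \<in> endomorphisms_of_degree scale U h"
      using \<phi> \<psi> by (auto simp: G_def)
    have MA: "\<phi> \<circ> \<psi> \<in> MA"
      using \<phi> \<psi> G_subset MA_subalgebra by (auto simp: endomorphism_subalgebra_def)
    moreover have "(\<phi> \<circ> \<psi>) x \<in> U (g + h + k)" if "x \<in> U k" for k x
      using gh that unfolding endomorphisms_of_degree_def
      by (auto simp: add.assoc image_subset_iff)
    ultimately show ?thesis
      using endo[OF MA] by (auto simp: G_def endomorphisms_of_degree_def)
  qed
  have comp1: "\<phi> \<circ> \<psi> \<in> End.span G" if \<phi>: "\<phi> \<in> G" and \<psi>: "\<psi> \<in> End.span G" for \<phi> \<psi>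
    using \<psi>
  proof (induction rule: End.span_induct)
    case base
    have "\<phi> \<in> endomorphisms scale"
      using \<phi> G_subset endo by blast
    then have lin: "\<phi> 0 = 0" "\<phi> (x + y) = \<phi> x + \<phi> y" "\<phi> (scale c x) = scale c (\<phi> x)" for x y c
      using endomorphism_zero by (simp_all add: endomorphisms_iff)
    have *: "\<phi> \<circ> 0 = 0" "\<phi> \<circ> (\<psi> + \<chi>) = (\<phi> \<circ> \<psi>) + (\<phi> \<circ> \<chi>)"
        "\<phi> \<circ> fun_scale scale c \<psi> = fun_scale scale c (\<phi> \<circ> \<psi>)" for \<psi> \<chi> c
      by (simp_all add: fun_eq_iff fun_scale_def lin)
    show ?case
      by (rule End.subspaceI; unfold mem_Collect_eq *; (rule End.span_zero | erule (1) End.span_add | erule End.span_scale))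
  next
    case (step \<psi>)
    show ?case
      by (rule End.span_base[OF comp_G[OF \<phi> step]])
  qed
  have comp: "\<phi> \<circ> \<psi> \<in> End.span G" if \<phi>: "\<phi> \<in> End.span G" and \<psi>: "\<psi> \<in> End.span G" for \<phi> \<psi>
    using \<phi>
  proof (induction rule: End.span_induct)
    case base
    have *: "0 \<circ> \<psi> = 0" "(\<phi> + \<chi>) \<circ> \<psi> = (\<phi> \<circ> \<psi>) + (\<chi> \<circ> \<psi>)"
        "fun_scale scale c \<phi> \<circ> \<psi> = fun_scale scale c (\<phi> \<circ> \<psi>)" for \<phi> \<chi> c
      by (auto simp: fun_eq_iff fun_scale_def)
    show ?case
      by (rule End.subspaceI; unfold mem_Collect_eq *; (rule End.span_zero | erule (1) End.span_add | erule End.span_scale))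
  next
    case (step \<phi>)
    show ?case
      using step \<psi> by (rule comp1)
  qed
  have "endomorphism_subalgebra scale (End.span G)"
    using span_subset endo comp by (auto simp: endomorphism_subalgebra_def End.subspace_span)
  moreover have "(\<lambda>x. mult a x) \<in> End.span G" for a
    using U_span[of a]
  proof (induction rule: span_induct)
    case base
    have "(\<lambda>x. mult 0 x) = 0" "(\<lambda>x. mult (a + b) x) = (\<lambda>x. mult a x) + (\<lambda>x. mult b x)"
        "(\<lambda>x. mult (scale c a) x) = fun_scale scale c (\<lambda>x. mult a x)" for a b c
      using mult_scale_left[of 0 _ 0] by (auto simp: fun_eq_iff fun_scale_def mult_add_left mult_scale_left)
    then show ?case
      by (simp add: subspace_def End.span_zero End.span_add End.span_scale)
  next
    case (step a)
    then obtain g where "a \<in> U g" by blast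
    then have "(\<lambda>x. mult a x) \<in> endomorphisms_of_degree scale U g"
      using endo[OF mult_in_MA(1)] mult_graded by (auto simp: endomorphisms_of_degree_def)
    then show ?case
      using mult_in_MA(1) by (intro End.span_base) (auto simp: G_def)
  qed
  moreover have "(\<lambda>x. mult x a) \<in> End.span G" for a
    using U_span[of a]
  proof (induction rule: span_induct)
    case base
    have "(\<lambda>x. mult x 0) = 0" "(\<lambda>x. mult x (a + b)) = (\<lambda>x. mult x a) + (\<lambda>x. mult x b)"
        "(\<lambda>x. mult x (scale c a)) = fun_scale scale c (\<lambda>x. mult x a)" for a b c
      using mult_scale_right[of _ 0 0] by (auto simp: fun_eq_iff fun_scale_def mult_add_right mult_scale_right)
    then show ?case
      by (simp add: subspace_def End.span_zero End.span_add End.span_scale)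
  next
    case (step a)
    then obtain g where "a \<in> U g" by blast
    then have "mult x a \<in> U (g + h)" if "x \<in> U h" for x h
      using that mult_graded[of x h a g] by (simp add: add.commute)
    then have "(\<lambda>x. mult x a) \<in> endomorphisms_of_degree scale U g"
      using endo[OF mult_in_MA(2)] by (auto simp: endomorphisms_of_degree_def)
    then show ?case
      using mult_in_MA(2) by (intro End.span_base) (auto simp: G_def)
  qed
  ultimately show "MA \<subseteq> End.span (\<Union>g. MA \<inter> endomorphisms_of_degree scale U g)"
    unfolding G_def by (intro MA_minimal) auto
qed

text \<open>
  The annihilator is cut out by the homogeneous elements of \<open>MA\<close>, and each of them sends the
  components of a vector into different degrees.
\<close>

lemma annihilator_homogeneous: "homogeneous_subspace scale U (annihilator mult)"
proof (rule homogeneous_subspaceI[OF grading])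
  show "subspace (annihilator mult)"
    unfolding annihilator_eq
  proof (rule subspaceI; clarsimp)
    show "\<phi> 0 = 0" if "\<phi> \<in> MA" for \<phi>
      using module.M_linear(3)[OF that] .
    show "\<phi> (x + y) = 0" if "\<forall>\<phi>\<in>MA. \<phi> x = 0" "\<forall>\<phi>\<in>MA. \<phi> y = 0" "\<phi> \<in> MA" for x y \<phi>
      using module.M_linear(1)[OF that(3)] that(1,2)[THEN bspec, OF that(3)] by simp
    show "\<phi> (scale c x) = 0" if "\<forall>\<phi>\<in>MA. \<phi> x = 0" "\<phi> \<in> MA" for c x \<phi>
      using module.M_linear(2)[OF that(2)] that(1)[THEN bspec, OF that(2)] by simp
  qed
  fix x assume x: "x \<in> annihilator mult"
  obtain S v where S: "finite S" "\<And>g. v g \<in> U g" "x = (\<Sum>g\<in>S. v g)"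
    by (rule span_Union_obtain[of U x]) (auto simp: module.component_subspace module.spanned_by_components)
  have "v g \<in> annihilator mult" if g: "g \<in> S" for g
    unfolding annihilator_iff
  proof
    fix \<phi> assume "\<phi> \<in> MA"
    then obtain T \<psi> where T: "finite T" "\<And>k. \<psi> k \<in> MA" "\<And>k. \<psi> k \<in> endomorphisms_of_degree scale U k"
        "\<phi> = (\<Sum>k\<in>T. \<psi> k)"
      using module.homogeneous_parts by blast
    have "\<psi> k (v g) = 0" for k
    proof (rule direct_sum_independent[OF grading S(1), of "\<lambda>g. k + g" "\<lambda>g. \<psi> k (v g)"])
      show "(\<Sum>g\<in>S. \<psi> k (v g)) = 0"
        using x[unfolded annihilator_iff, THEN bspec, OF T(2)] by (simp add: S(3) module.M_linear(5)[OF T(2)])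
      show "\<psi> k (v h) \<in> U (k + h)" for h
        using T(3) S(2) by (rule module.degree_apply)
    qed (use g in \<open>auto simp: inj_on_def\<close>)
    then show "\<phi> (v g) = 0"
      by (simp add: T(4) sum_fun_eval)
  qed
  then show "x \<in> span (\<Union>g. annihilator mult \<inter> U g)"
    unfolding S(3) using S(2) by (intro span_sum span_base) blast
qed

section \<open>Graded simplicity of an algebra and of its multiplication algebra\<close>

lemma centroid_eq: "graded_centroid scale mult U = module.centralizer"
  by (simp add: graded_centroid_def module.centralizer_def)

lemma component_eq:
  "multiplication_algebra_component scale mult U = (\<lambda>g. MA \<inter> endomorphisms_of_degree scale U g)"
  by (simp add: multiplication_algebra_component_def fun_eq_iff)

lemma annihilator_zero_of_graded_simple:
  assumes "graded_simple_algebra scale UNIV mult U"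
  shows "annihilator mult = {0}"
proof -
  interpret graded_simple_algebra scale UNIV mult U by fact
  have "\<psi> (\<phi> x) = 0" if "x \<in> annihilator mult" "\<phi> \<in> MA" "\<psi> \<in> MA" for \<phi> \<psi> x
    using that(1)[unfolded annihilator_iff, THEN bspec, OF that(2)] module.M_linear(3)[OF that(3)] by simp
  then have "two_sided_ideal scale UNIV mult (annihilator mult)"
    using homogeneous_subspace_subspace[OF annihilator_homogeneous]
    by (simp add: two_sided_ideal_iff annihilator_iff)
  then have "annihilator mult = {0} \<or> annihilator mult = UNIV"
    using no_proper_ideals annihilator_homogeneous by blast
  moreover have "annihilator mult \<noteq> UNIV"
  proof
    assume "annihilator mult = UNIV"
    then have "mult x y = 0" for x y
      by (auto simp: annihilator_def)
    then show False
      using square_nonzero by (simp add: subspace_single_0)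
  qed
  ultimately show ?thesis by blast
qed

lemma irreducible_of_graded_simple:
  assumes simple: "graded_simple_algebra scale UNIV mult U"
  shows "graded_irreducible_space scale U MA"
proof -
  interpret graded_simple_algebra scale UNIV mult U by fact
  show ?thesis
  proof
    show "homogeneous_subspace scale U UNIV"
      by (rule homogeneous_subspaceI[OF grading]) (simp_all add: module.spanned_by_components)
    show "W = {0} \<or> W = UNIV"
      if "homogeneous_subspace scale U W" "\<And>\<phi> x. \<phi> \<in> MA \<Longrightarrow> x \<in> W \<Longrightarrow> \<phi> x \<in> W" for W
      using that no_proper_ideals[of W] homogeneous_subspace_subspace[OF that(1)]
      by (simp add: two_sided_ideal_iff)
    show "x = 0" if "\<And>\<phi>. \<phi> \<in> MA \<Longrightarrow> \<phi> x = 0" for x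
      using that annihilator_iff[of x] annihilator_zero_of_graded_simple[OF simple] by blast
  qed simp_all
qed

text \<open>
  The least nonzero homogeneous ideal \<open>V\<close>, spanned by \<open>M U\<close>, is a faithful irreducible module. An element
  \<open>e\<close> of \<open>M\<close> acting on it as the identity satisfies \<open>\<phi> e = \<phi>\<close> for all \<open>\<phi>\<close> in \<open>M\<close>, and the vanishing of
  the annihilator turns this into \<open>e x = x\<close> for all \<open>x\<close>. As \<open>e x\<close> lies in \<open>V\<close>, nothing lies outside \<open>V\<close>.
\<close>

lemma graded_simple_of_multiplication_algebra:
  assumes simple: "graded_simple_algebra (fun_scale scale) MA (\<circ>)
      (\<lambda>g. MA \<inter> endomorphisms_of_degree scale U g)"
    and ann: "annihilator mult = {0}"
    and PI: "satisfies_polynomial_identity (fun_scale scale) MA (\<circ>) id"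
  shows "graded_simple_algebra scale UNIV mult U"
proof -
  interpret S: graded_simple_algebra "fun_scale scale" MA "(\<circ>)"
      "\<lambda>g. MA \<inter> endomorphisms_of_degree scale U g" by fact
  have nondeg: "x = 0" if "\<And>\<phi>. \<phi> \<in> MA \<Longrightarrow> \<phi> x = 0" for x
    using that annihilator_iff[of x] ann by blast
  have UNIV_hom: "homogeneous_subspace scale U UNIV"
    by (rule homogeneous_subspaceI[OF grading]) (simp_all add: module.spanned_by_components)
  have image: "\<phi> x \<in> I"
    if I: "homogeneous_subspace scale U I" "I \<noteq> {0}" "\<And>\<phi> x. \<phi> \<in> MA \<Longrightarrow> x \<in> I \<Longrightarrow> \<phi> x \<in> I"
      and \<phi>: "\<phi> \<in> MA" for I \<phi> x
  proof -
    define J where "J = {\<phi> \<in> MA. \<forall>x\<in>UNIV. \<phi> x \<in> I}"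
    have hom: "homogeneous_subspace (fun_scale scale) (\<lambda>g. MA \<inter> endomorphisms_of_degree scale U g) J"
      unfolding J_def by (rule module.transporter_homogeneous[OF UNIV_hom I(1)])
    then have "two_sided_ideal (fun_scale scale) MA (\<circ>) J"
      using I(3) module.M_closed(2) End.homogeneous_subspace_subspace[OF hom]
      by (auto simp: two_sided_ideal_def J_def)
    then have "J = {0} \<or> J = MA"
      using hom S.no_proper_ideals by blast
    moreover have "J \<noteq> {0}"
    proof -
      obtain a where a: "a \<in> I" "a \<noteq> 0"
        using I(2) subspace_0[OF homogeneous_subspace_subspace[OF I(1)]] by auto
      have "(\<lambda>x. mult a x) \<in> J" "(\<lambda>x. mult x a) \<in> J"
        using I(3)[OF mult_in_MA(1) a(1)] I(3)[OF mult_in_MA(2) a(1)] mult_in_MA by (auto simp: J_def)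
      moreover have "a \<notin> annihilator mult"
        using ann a(2) by simp
      ultimately show ?thesis
        by (auto simp: annihilator_def fun_eq_iff)
    qed
    ultimately show ?thesis
      using \<phi> by (auto simp: J_def)
  qed
  define V where "V = span {\<phi> x |\<phi> x. \<phi> \<in> MA}"
  have V_mem: "\<phi> x \<in> V" if "\<phi> \<in> MA" for \<phi> x
    unfolding V_def using that by (intro span_base) blast
  have V_hom: "homogeneous_subspace scale U V"
  proof (rule homogeneous_subspaceI[OF grading])
    show "subspace V"
      by (simp add: V_def subspace_span)
    have "\<phi> x \<in> span (\<Union>g. V \<inter> U g)" if \<phi>: "\<phi> \<in> MA" for \<phi> x
    proof -
      obtain T \<psi> where T: "\<And>k. \<psi> k \<in> MA" "\<And>k. \<psi> k \<in> endomorphisms_of_degree scale U k"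
          "\<phi> = (\<Sum>k\<in>T. \<psi> k)"
        using module.homogeneous_parts[OF \<phi>] by blast
      obtain S v where v: "\<And>g. v g \<in> U g" "x = (\<Sum>g\<in>S. v g)"
        using homogeneous_subspace_obtain[OF UNIV_hom UNIV_I] by metis
      have "\<phi> x = (\<Sum>k\<in>T. \<Sum>g\<in>S. \<psi> k (v g))"
        by (simp add: T(3) v(2) sum_fun_eval module.M_linear(5)[OF T(1)])
      moreover have "\<psi> k (v g) \<in> (\<Union>g. V \<inter> U g)" for k g
        using V_mem[OF T(1)] module.degree_apply[OF T(2) v(1)] by blast
      ultimately show ?thesis
        by (simp add: span_sum span_base)
    qed
    then have "V \<subseteq> span (\<Union>g. V \<inter> U g)"
      unfolding V_def by (intro span_minimal subspace_span) (auto simp: V_def)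
    then show "x \<in> span (\<Union>g. V \<inter> U g)" if "x \<in> V" for x
      using that by blast
  qed
  have V_least: "V \<subseteq> I"
    if "homogeneous_subspace scale U I" "I \<noteq> {0}" "\<And>\<phi> x. \<phi> \<in> MA \<Longrightarrow> x \<in> I \<Longrightarrow> \<phi> x \<in> I" for I
    unfolding V_def
    by (rule span_minimal) (use image[OF that(1,2)] that(3) homogeneous_subspace_subspace[OF that(1)] in blast)+
  have V_nonzero: "V \<noteq> {0}"
  proof
    assume "V = {0}"
    then have "{\<phi> \<circ> \<psi> |\<phi> \<psi>. \<phi> \<in> MA \<and> \<psi> \<in> MA} \<subseteq> {0}"
      using V_mem by (fastforce simp: fun_eq_iff)
    then have "End.span {\<phi> \<circ> \<psi> |\<phi> \<psi>. \<phi> \<in> MA \<and> \<psi> \<in> MA} \<subseteq> {0}"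
      by (rule End.span_minimal) (simp add: End.subspace_def)
    then show False
      using S.square_nonzero End.span_zero by blast
  qed
  interpret V: graded_irreducible_module scale U MA V
  proof
    show "W = {0} \<or> W = V"
      if "W \<subseteq> V" "homogeneous_subspace scale U W" "\<And>\<phi> x. \<phi> \<in> MA \<Longrightarrow> x \<in> W \<Longrightarrow> \<phi> x \<in> W" for W
      using V_least[of W] that by blast
  qed (use V_hom V_mem nondeg in auto)
  have faithful: "\<phi> = 0" if "\<phi> \<in> MA" "\<And>x. x \<in> V \<Longrightarrow> \<phi> x = 0" for \<phi>
  proof -
    define K where "K = {\<phi> \<in> MA. \<forall>x\<in>V. \<phi> x \<in> {0}}"
    have hom: "homogeneous_subspace (fun_scale scale) (\<lambda>g. MA \<inter> endomorphisms_of_degree scale U g) K"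
      unfolding K_def
      by (rule module.transporter_homogeneous[OF V_hom homogeneous_subspace_zero[OF grading]])
    have "\<psi> \<circ> \<phi> \<in> K \<and> \<phi> \<circ> \<psi> \<in> K" if \<phi>: "\<phi> \<in> K" and \<psi>: "\<psi> \<in> MA" for \<phi> \<psi>
      using \<phi> V_mem[OF \<psi>] module.M_linear(3)[OF \<psi>] module.M_closed(2)[OF \<psi>] module.M_closed(2)[OF _ \<psi>]
      by (simp add: K_def)
    moreover have "K \<subseteq> MA"
      by (auto simp: K_def)
    ultimately have "two_sided_ideal (fun_scale scale) MA (\<circ>) K"
      using End.homogeneous_subspace_subspace[OF hom] by (simp add: two_sided_ideal_def)
    then have "K = {0} \<or> K = MA"
      using hom S.no_proper_ideals by blast
    moreover have "K \<noteq> MA"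
    proof
      assume "K = MA"
      have "x = 0" if x: "x \<in> V" for x
      proof (rule nondeg)
        fix \<phi> assume "\<phi> \<in> MA"
        then have "\<phi> \<in> K"
          by (simp only: \<open>K = MA\<close>)
        then show "\<phi> x = 0"
          using x by (simp add: K_def)
      qed
      then show False
        using V_nonzero subspace_0[OF V.V_subspace] by blast
    qed
    moreover have "\<phi> \<in> K"
      using that by (simp add: K_def)
    ultimately show ?thesis by blast
  qed
  obtain e where e: "e \<in> MA" "\<And>x. x \<in> V \<Longrightarrow> e x = x"
    using V.exists_identity[OF PI] by metis
  have "V = UNIV"
  proof -
    have "e x - x = 0" for x
    proof (rule nondeg)
      fix \<phi> assume \<phi>: "\<phi> \<in> MA"
      have "(\<phi> \<circ> e) - \<phi> = 0"
      proof (rule faithful)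
        show "(\<phi> \<circ> e) - \<phi> \<in> MA"
          by (intro End.subspace_diff[OF module.M_closed(1)] module.M_closed(2) \<phi> e(1))
      qed (simp add: e(2))
      from fun_cong[OF this, of x] show "\<phi> (e x - x) = 0"
        using module.M_linear(4)[OF \<phi>] by simp
    qed
    then have "x \<in> V" for x
      using V_mem[OF e(1), of x] by simp
    then show ?thesis by blast
  qed
  show ?thesis
  proof
    show "span {mult x y |x y. x \<in> UNIV \<and> y \<in> UNIV} \<noteq> {0}"
    proof
      assume "span {mult x y |x y. x \<in> UNIV \<and> y \<in> UNIV} = {0}"
      then have "mult x y = 0" for x y
        using span_base[of "mult x y" "{mult x y |x y. x \<in> UNIV \<and> y \<in> UNIV}"] by blast
      then have "annihilator mult = UNIV"
        by (simp add: annihilator_def)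
      with ann \<open>V = UNIV\<close> V_nonzero show False
        by simp
    qed
    show "I = {0} \<or> I = UNIV"
      if "two_sided_ideal scale UNIV mult I" "homogeneous_subspace scale U I" for I
      using V_least[of I] that \<open>V = UNIV\<close> by (auto simp: two_sided_ideal_iff)
  qed
qed

end

theorem proposition7:
  fixes scale :: "'f::field \<Rightarrow> 'u::ab_group_add \<Rightarrow> 'u"
    and mult :: "'u \<Rightarrow> 'u \<Rightarrow> 'u"
    and U :: "'g::ab_group_add \<Rightarrow> 'u set"
  assumes "graded_algebra scale UNIV mult U"
    and "satisfies_polynomial_identity (fun_scale scale) (multiplication_algebra scale mult) (\<circ>) id"
  shows "(graded_simple_algebra scale UNIV mult U \<longleftrightarrow>
            graded_simple_algebra (fun_scale scale) (multiplication_algebra scale mult) (\<circ>)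
              (multiplication_algebra_component scale mult U)
            \<and> annihilator mult = {0}) \<and>
         (graded_simple_algebra scale UNIV mult U \<longrightarrow>
            (\<exists>B. finite B \<and> graded_basis (graded_centroid scale mult U) U B) \<and>
            multiplication_algebra scale mult
              = endomorphisms_over scale (graded_centroid scale mult U))"
proof -
  interpret full_graded_algebra scale mult U
    unfolding full_graded_algebra_def by (rule assms(1))
  have "graded_simple_algebra (fun_scale scale) MA (\<circ>) (\<lambda>g. MA \<inter> endomorphisms_of_degree scale U g)
      \<and> annihilator mult = {0}
      \<and> (\<exists>B. finite B \<and> graded_basis module.centralizer U B)
      \<and> MA = endomorphisms_over scale module.centralizer"
    if simple: "graded_simple_algebra scale UNIV mult U"
  proof -
    interpret irr: graded_irreducible_space scale U MA
      by (rule irreducible_of_graded_simple[OF simple])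
    have ann: "annihilator mult = {0}"
      by (rule annihilator_zero_of_graded_simple[OF simple])
    have "(UNIV :: 'u set) \<noteq> {0}"
    proof
      assume "(UNIV :: 'u set) = {0}"
      then have "span X = {0}" for X :: "'u set"
        using span_zero[of X] by (metis UNIV_I singletonD subsetI subset_antisym subset_UNIV singleton_iff)
      then show False
        using graded_simple_algebra.square_nonzero[OF simple] by blast
    qed
    then show ?thesis
      using ann irr.graded_simple_of_endomorphisms[OF assms(2)] irr.double_centralizer[OF assms(2)]
        irr.finite_graded_basis[OF assms(2)]
      by (metis finite_set)
  qed
  then show ?thesis
    unfolding component_eq centroid_eq
    using graded_simple_of_multiplication_algebra[OF _ _ assms(2)] by blast
qed

end
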